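(* For every integer $d\ge2$ there exists a $C^\infty$ area-preserving (i.e. Lebesgue-measure-preserving) and minimal diffeomorphism $f:\mathbb{T}^d\to\mathbb{T}^d$ that is semi-conjugate to a translation by a map homotopic to the identity, but is not topologically conjugate to a translation. Moreover, $f$ can be required to have super-Liouvillean rotation vector.
   Context: $\mathbb{T}^d=\mathbb{R}^d/\mathbb{Z}^d$; the translation by $v$ is $T_v(z)=z+v$. $f$ is semi-conjugate to $T_v$ by a map homotopic to the identity if there is a continuous surjection $h:\mathbb{T}^d\to\mathbb{T}^d$ homotopic to $\mathrm{Id}_{\mathbb{T}^d}$ with $hf=T_vh$. In this case, for any lift $\tilde f:\mathbb{R}^d\to\mathbb{R}^d$ of $f$, the limit $\lim_{n\to\infty}(\tilde f^n(z)-z)/n$ exists and is independent of $z$; its class mod $\mathbb{Z}^d$ is the rotation vector $\rho(f)$ of $f$. A rotation vector $\omega\bmod\mathbb{Z}^d$ is super-Liouvillean if $$\liminf_{n\to+\infty}n^{-1}\ln\|n\omega\|_{\mathbb{T}^d}=-\infty,\qquad \|\omega\|_{\mathbb{T}^d}=\min_{z\in\mathbb{Z}^d}\|\omega-z\|$$ with $\|\cdot\|$ the Euclidean norm. $f$ is minimal if every orbit is dense. *)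

theory Defs
  imports "HOL-Analysis.Analysis"
begin

section \<open>The torus as a topological abelian group\<close>

definition int_lattice :: "(real ^ 'n) set" where
  "int_lattice = {m. \<forall>i. m $ i \<in> \<int>}"

definition int_cong :: "real ^ 'n \<Rightarrow> real ^ 'n \<Rightarrow> bool" where
  "int_cong x y \<longleftrightarrow> x - y \<in> int_lattice"

lemma int_lattice_0 [simp]: "0 \<in> int_lattice"
  by (simp add: int_lattice_def)

lemma int_lattice_add: "x \<in> int_lattice \<Longrightarrow> y \<in> int_lattice \<Longrightarrow> x + y \<in> int_lattice"
  by (simp add: int_lattice_def)

lemma int_lattice_minus: "x \<in> int_lattice \<Longrightarrow> - x \<in> int_lattice"
  by (simp add: int_lattice_def)

lemma int_cong_add: "int_cong a b \<Longrightarrow> int_cong c d \<Longrightarrow> int_cong (a + c) (b + d)"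
  unfolding int_cong_def by (simp add: int_lattice_add add_diff_add)

lemma int_cong_minus: "int_cong a b \<Longrightarrow> int_cong (- a) (- b)"
  unfolding int_cong_def by (drule int_lattice_minus) simp

lemma equivp_int_cong: "equivp (int_cong :: real ^ 'n \<Rightarrow> _)"
proof (rule equivpI)
  show "reflp (int_cong :: real ^ 'n \<Rightarrow> _)"
    by (simp add: reflp_def int_cong_def)
  show "symp (int_cong :: real ^ 'n \<Rightarrow> _)"
    by (rule sympI) (use int_lattice_minus in \<open>fastforce simp: int_cong_def\<close>)
  show "transp (int_cong :: real ^ 'n \<Rightarrow> _)"
  proof (rule transpI)
    fix x y z :: "real ^ 'n"
    assume "int_cong x y" "int_cong y z"
    then have "(x - y) + (y - z) \<in> int_lattice"
      unfolding int_cong_def by (rule int_lattice_add)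
    then show "int_cong x z"
      by (simp add: int_cong_def)
  qed
qed

quotient_type 'n torus = "real ^ 'n" / int_cong
  morphisms rep_torus torus_proj
  by (rule equivp_int_cong)

lemma torus_proj_eq_iff: "torus_proj x = torus_proj y \<longleftrightarrow> x - y \<in> int_lattice"
  using torus.abs_eq_iff[of x y] by (simp add: int_cong_def)

instantiation torus :: (finite) ab_group_add
begin

lift_definition zero_torus :: "'a torus" is 0 .

lift_definition plus_torus :: "'a torus \<Rightarrow> 'a torus \<Rightarrow> 'a torus" is "(+)"
  by (rule int_cong_add)

lift_definition uminus_torus :: "'a torus \<Rightarrow> 'a torus" is uminus
  by (rule int_cong_minus)

lift_definition minus_torus :: "'a torus \<Rightarrow> 'a torus \<Rightarrow> 'a torus" is "(-)"
  unfolding diff_conv_add_uminus by (intro int_cong_add int_cong_minus)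

instance
  by standard (transfer; simp add: int_cong_def algebra_simps)+

end

instantiation torus :: (finite) topological_space
begin

definition open_torus :: "'a torus set \<Rightarrow> bool" where
  "open_torus U \<longleftrightarrow> open (torus_proj -` U)"

instance
  by standard (simp_all add: open_torus_def vimage_Union open_Int open_UN)

end

lemma continuous_on_torus_proj: "continuous_on UNIV torus_proj"
  by (simp add: continuous_on_open_vimage open_torus_def)

definition torus_translation :: "'n::finite torus \<Rightarrow> 'n torus \<Rightarrow> 'n torus" where
  "torus_translation v z = z + v"


section \<open>Smooth maps and Lebesgue measure on the torus\<close>

fun Ck :: "nat \<Rightarrow> ('a::euclidean_space \<Rightarrow> 'b::euclidean_space) \<Rightarrow> bool" where
  "Ck 0 F \<longleftrightarrow> continuous_on UNIV F"
| "Ck (Suc k) F \<longleftrightarrow>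
    (\<forall>x. F differentiable (at x)) \<and> (\<forall>v. Ck k (\<lambda>x. frechet_derivative F (at x) v))"

definition is_lift :: "('n::finite torus \<Rightarrow> 'n torus) \<Rightarrow> (real ^ 'n \<Rightarrow> real ^ 'n) \<Rightarrow> bool" where
  "is_lift f F \<longleftrightarrow> continuous_on UNIV F \<and> (\<forall>x. torus_proj (F x) = f (torus_proj x))"

text \<open>
  As \<open>torus_proj\<close> is the universal covering and a local diffeomorphism, a map of the torus is
  smooth in the charts of the quotient iff it has a smooth lift.
\<close>

definition smooth_torus_map :: "('n::finite torus \<Rightarrow> 'n torus) \<Rightarrow> bool" where
  "smooth_torus_map f \<longleftrightarrow> (\<exists>F. is_lift f F \<and> (\<forall>k. Ck k F))"

definition smooth_torus_diffeo :: "('n::finite torus \<Rightarrow> 'n torus) \<Rightarrow> bool" where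
  "smooth_torus_diffeo f \<longleftrightarrow> bij f \<and> smooth_torus_map f \<and> smooth_torus_map (inv f)"

definition torus_lebesgue :: "'n::finite torus measure" where
  "torus_lebesgue =
    distr (restrict_space lborel {x. \<forall>i. 0 \<le> x $ i \<and> x $ i < 1}) borel torus_proj"

text \<open>
  The term \<open>distr M N f\<close> is only the push-forward measure if \<open>f\<close> is measurable.
\<close>

lemma measurable_torus_proj: "torus_proj \<in> measurable (restrict_space lborel S) borel"
proof -
  have "torus_proj \<in> measurable borel borel"
    by (rule borel_measurable_continuous_onI[OF continuous_on_torus_proj])
  then show ?thesis
    by (intro measurable_restrict_space1) simp
qed

definition lebesgue_preserving :: "('n::finite torus \<Rightarrow> 'n torus) \<Rightarrow> bool" where
  "lebesgue_preserving f \<longleftrightarrow>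
    f \<in> measurable torus_lebesgue torus_lebesgue \<and>
    distr torus_lebesgue torus_lebesgue f = torus_lebesgue"


section \<open>Dynamical notions\<close>

text \<open>
  Forward orbits are used; for homeomorphisms of a compact space, density of all forward orbits
  is equivalent to density of all two-sided orbits.
\<close>

definition minimal_map :: "('a::topological_space \<Rightarrow> 'a) \<Rightarrow> bool" where
  "minimal_map f \<longleftrightarrow> (\<forall>x. closure (range (\<lambda>n. (f ^^ n) x)) = UNIV)"

definition semiconj_to_translation_htpy_id :: "('n::finite torus \<Rightarrow> 'n torus) \<Rightarrow> bool" where
  "semiconj_to_translation_htpy_id f \<longleftrightarrow>
    (\<exists>v h. continuous_on UNIV h \<and> surj h \<and>
      homotopic_with_canon (\<lambda>_. True) UNIV UNIV h id \<and>
      h \<circ> f = torus_translation v \<circ> h)"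

definition conj_to_translation :: "('n::finite torus \<Rightarrow> 'n torus) \<Rightarrow> bool" where
  "conj_to_translation f \<longleftrightarrow>
    (\<exists>v (h :: 'n torus \<Rightarrow> 'n torus) g. homeomorphism UNIV UNIV h g \<and> h \<circ> f = torus_translation v \<circ> h)"

definition has_rotation_vector :: "('n::finite torus \<Rightarrow> 'n torus) \<Rightarrow> 'n torus \<Rightarrow> bool" where
  "has_rotation_vector f \<rho> \<longleftrightarrow>
    (\<exists>F. is_lift f F) \<and>
    (\<forall>F. is_lift f F \<longrightarrow>
      (\<exists>w. torus_proj w = \<rho> \<and>
        (\<forall>z. (\<lambda>n. ((F ^^ n) z - z) /\<^sub>R real n) \<longlonglongrightarrow> w)))"

definition torus_norm :: "real ^ 'n \<Rightarrow> real" where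
  "torus_norm w = (INF m\<in>int_lattice. norm (w - m))"

text \<open>
  The library's \<open>ln 0 = 0\<close> is replaced by \<open>ln 0 = -\<infinity>\<close>.
\<close>

definition ext_ln :: "real \<Rightarrow> ereal" where
  "ext_ln x = (if x \<le> 0 then -\<infinity> else ereal (ln x))"

definition super_liouvillean :: "real ^ 'n \<Rightarrow> bool" where
  "super_liouvillean w \<longleftrightarrow>
    liminf (\<lambda>n. ereal (1 / real n) * ext_ln (torus_norm (real n *\<^sub>R w))) = -\<infinity>"

end

theory Submission
  imports Defs
begin

text \<open>
  The map is built by the Anosov--Katok method on lifts to \<open>\<real>\<^sup>d\<close>, as the limit of
  \<open>F\<^sub>n = H\<^sub>n \<circ> T\<^bsub>w\<^sub>n\<^esub> \<circ> H\<^sub>n\<inverse>\<close> where \<open>w\<^sub>n\<close> is rational and \<open>H\<^sub>n\<^sub>+\<^sub>1 = H\<^sub>n \<circ> S\<^sub>n\<close> with a volume-preserving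
  composition \<open>S\<^sub>n\<close> of two shears commuting with the translation by \<open>w\<^sub>n\<close>. As \<open>F\<^sub>n\<close> does not change when
  \<open>H\<^sub>n\<close> is replaced by \<open>H\<^sub>n\<^sub>+\<^sub>1\<close>, moving \<open>w\<^sub>n\<close> slightly to a \<open>w\<^sub>n\<^sub>+\<^sub>1\<close> with very dense orbits changes \<open>F\<^sub>n\<close>
  and its inverse as little as desired in every \<open>C\<^sup>k\<close>-norm. Density of orbits up to \<open>\<epsilon>\<close> is a
  \<open>C\<^sup>0\<close>-open condition, so the limit is minimal, and \<open>w\<^sub>n\<close> converging fast makes the limit \<open>w\<close>
  super-Liouvillean.

  The shears are chosen so that \<open>H\<^sub>n\<inverse>\<close> brings two fixed points \<open>0\<close> and \<open>p\<close> closer and closer together,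
  at summable speed. So \<open>H\<^sub>n\<inverse>\<close> converges uniformly to some \<open>h\<close> with \<open>h \<circ> F = T\<^sub>w \<circ> h\<close>. If \<open>e\<^sub>n\<close> is the
  difference of the images of \<open>p\<close> and \<open>0\<close>, there is a point \<open>a\<close> such that \<open>S\<^sub>n (a + e\<^sub>n)\<close> is close to \<open>S\<^sub>n a\<close>; an
  iterate of the translation carries the two images near \<open>a\<close> and \<open>a + e\<^sub>n\<close>, whence \<open>0\<close> and \<open>p\<close> come close
  together under iterates of \<open>F\<close>. So they form a proximal pair, which translations do not have.
\<close>

section \<open>Smooth maps between Euclidean spaces\<close>

definition smooth :: "('a::euclidean_space \<Rightarrow> 'b::euclidean_space) \<Rightarrow> bool" where
  "smooth F \<longleftrightarrow> (\<forall>k. Ck k F)"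

definition dderiv :: "'a::euclidean_space \<Rightarrow> ('a \<Rightarrow> 'b::euclidean_space) \<Rightarrow> 'a \<Rightarrow> 'b" where
  "dderiv v F x = frechet_derivative F (at x) v"

lemma Ck_SucI:
  assumes "\<And>x. (F has_derivative F' x) (at x)" and "\<And>v. Ck k (\<lambda>x. F' x v)"
  shows "Ck (Suc k) F"
proof -
  have "frechet_derivative F (at x) = F' x" for x
    using frechet_derivative_at[OF assms(1)] by simp
  then show ?thesis
    using assms by (auto simp: differentiable_def)
qed

lemma Ck_SucD:
  assumes "Ck (Suc k) F"
  shows "(F has_derivative frechet_derivative F (at x)) (at x)" and "Ck k (\<lambda>x. frechet_derivative F (at x) v)"
  using assms by (simp_all add: frechet_derivative_works)

lemma Ck_continuous: "Ck k F \<Longrightarrow> continuous_on UNIV F"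
  by (cases k) (auto intro: differentiable_imp_continuous_on simp: differentiable_on_def)

lemma Ck_Suc_imp: "Ck (Suc k) F \<Longrightarrow> Ck k F"
proof (induction k arbitrary: F)
  case 0
  show ?case using Ck_continuous[OF 0] by simp
next
  case (Suc k)
  then show ?case by (subst Ck.simps(2)) (use Suc.prems in force)
qed

lemma Ck_const: "Ck k (\<lambda>x::'a::euclidean_space. c::'b::euclidean_space)"
proof (induction k arbitrary: c)
  case (Suc k)
  show ?case by (rule Ck_SucI[where F' = "\<lambda>_ _. 0"]) (auto intro: Suc)
qed simp

lemma Ck_linear:
  fixes f :: "'b::euclidean_space \<Rightarrow> 'c::euclidean_space"
  assumes "bounded_linear f" "Ck k G"
  shows "Ck k (\<lambda>x. f (G x))"
  using assms(2)
proof (induction k arbitrary: G)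
  case 0
  then show ?case by (simp add: bounded_linear.continuous_on[OF assms(1)])
next
  case (Suc k)
  show ?case
  proof (rule Ck_SucI)
    show "((\<lambda>x. f (G x)) has_derivative (\<lambda>v. f (frechet_derivative G (at x) v))) (at x)" for x
      by (rule bounded_linear.has_derivative[OF assms(1)]) (rule Ck_SucD(1)[OF Suc.prems])
    show "Ck k (\<lambda>x. f (frechet_derivative G (at x) v))" for v
      by (rule Suc.IH) (rule Ck_SucD(2)[OF Suc.prems])
  qed
qed

lemma Ck_id: "Ck k (\<lambda>x::'a::euclidean_space. x)"
proof (cases k)
  case (Suc k)
  then show ?thesis
    by (simp only:) (rule Ck_SucI[where F' = "\<lambda>x v. v"], auto intro: Ck_const has_derivative_ident)
qed simp

lemma Ck_add:
  assumes "Ck k F" "Ck k G"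
  shows "Ck k (\<lambda>x. F x + G x)"
  using assms
proof (induction k arbitrary: F G)
  case 0
  then show ?case by (simp add: continuous_on_add continuous_on_scaleR)
next
  case (Suc k)
  show ?case
  proof (rule Ck_SucI)
    show "((\<lambda>x. F x + G x) has_derivative
        (\<lambda>v. frechet_derivative F (at x) v + frechet_derivative G (at x) v)) (at x)" for x
      by (rule has_derivative_add[OF Ck_SucD(1)[OF Suc.prems(1)] Ck_SucD(1)[OF Suc.prems(2)]])
    show "Ck k (\<lambda>x. frechet_derivative F (at x) v + frechet_derivative G (at x) v)" for v
      by (rule Suc.IH[OF Ck_SucD(2)[OF Suc.prems(1)] Ck_SucD(2)[OF Suc.prems(2)]])
  qed
qed

lemma Ck_sum: "(\<And>i. i \<in> I \<Longrightarrow> Ck k (F i)) \<Longrightarrow> Ck k (\<lambda>x. \<Sum>i\<in>I. F i x)"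
  by (induction I rule: infinite_finite_induct) (simp_all add: Ck_const Ck_add)

lemma Ck_scaleR:
  assumes "Ck k f" "Ck k G"
  shows "Ck k (\<lambda>x. f x *\<^sub>R G x)"
  using assms
proof (induction k arbitrary: f G)
  case 0
  then show ?case by (simp add: continuous_on_add continuous_on_scaleR)
next
  case (Suc k)
  show ?case
  proof (rule Ck_SucI)
    show "((\<lambda>x. f x *\<^sub>R G x) has_derivative
       (\<lambda>v. f x *\<^sub>R frechet_derivative G (at x) v + frechet_derivative f (at x) v *\<^sub>R G x)) (at x)" for x
      by (rule has_derivative_scaleR[OF Ck_SucD(1)[OF Suc.prems(1)] Ck_SucD(1)[OF Suc.prems(2)]])
    show "Ck k (\<lambda>x. f x *\<^sub>R frechet_derivative G (at x) v + frechet_derivative f (at x) v *\<^sub>R G x)" for v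
      by (intro Ck_add Suc.IH Ck_SucD(2)[OF Suc.prems(1)] Ck_SucD(2)[OF Suc.prems(2)] Ck_Suc_imp[OF Suc.prems(1)] Ck_Suc_imp[OF Suc.prems(2)])
  qed
qed

lemma linear_Basis_expand:
  assumes "linear f"
  shows "f v = (\<Sum>b\<in>Basis. (v \<bullet> b) *\<^sub>R f b)"
proof -
  have "f (\<Sum>b\<in>Basis. (v \<bullet> b) *\<^sub>R b) = (\<Sum>b\<in>Basis. (v \<bullet> b) *\<^sub>R f b)"
    by (simp only: linear_sum[OF assms] linear_cmul[OF assms])
  then show ?thesis by (simp only: euclidean_representation)
qed

lemma Ck_compose:
  assumes "Ck k F" "Ck k G"
  shows "Ck k (\<lambda>x. F (G x))"
  using assms
proof (induction k arbitrary: F G)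
  case 0
  then show ?case by (auto intro: continuous_on_compose2)
next
  case (Suc k)
  let ?DF = "\<lambda>y. frechet_derivative F (at y)" and ?DG = "\<lambda>x. frechet_derivative G (at x)"
  show ?case
  proof (rule Ck_SucI)
    fix x
    have lin: "linear (?DF (G x))"
      by (rule has_derivative_linear[OF Ck_SucD(1)[OF Suc.prems(1)]])
    have "((\<lambda>x. F (G x)) has_derivative (\<lambda>v. ?DF (G x) (?DG x v))) (at x)"
      using has_derivative_compose[OF Ck_SucD(1)[OF Suc.prems(2)] Ck_SucD(1)[OF Suc.prems(1)]] .
    \<comment> \<open>The direction \<open>?DG x v\<close> varies with \<open>x\<close>, whereas
      \<open>Ck\<close> differentiates in fixed directions. Expanding it in \<open>Basis\<close>
      leaves a sum of products to which the induction hypothesis applies.\<close>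
    then show "((\<lambda>x. F (G x)) has_derivative (\<lambda>v. \<Sum>b\<in>Basis. (?DG x v \<bullet> b) *\<^sub>R ?DF (G x) b)) (at x)"
      by (simp only: linear_Basis_expand[OF lin, symmetric])
  next
    fix v
    have 1: "Ck k (\<lambda>x. ?DF (G x) b)" for b
      by (rule Suc.IH[of "\<lambda>y. ?DF y b" G])
        (rule Ck_SucD(2)[OF Suc.prems(1)], rule Ck_Suc_imp[OF Suc.prems(2)])
    have 2: "Ck k (\<lambda>x. ?DG x v \<bullet> b)" for b
      by (rule Ck_linear[OF bounded_linear_inner_left]) (rule Ck_SucD(2)[OF Suc.prems(2)])
    show "Ck k (\<lambda>x. \<Sum>b\<in>Basis. (?DG x v \<bullet> b) *\<^sub>R ?DF (G x) b)"
      by (rule Ck_sum, rule Ck_scaleR[OF 2 1])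
  qed
qed

lemma Ck_sin_cos: "Ck k (sin :: real \<Rightarrow> real) \<and> Ck k (cos :: real \<Rightarrow> real)"
proof (induction k)
  case 0
  then show ?case by (simp add: continuous_on_sin continuous_on_cos)
next
  case (Suc k)
  have 1: "Ck k (\<lambda>x::real. cos x * v)" for v :: real
    using Ck_linear[OF bounded_linear_mult_left] Suc by blast
  have 2: "Ck k (\<lambda>x::real. - sin x * v)" for v :: real
    using Ck_linear[OF bounded_linear_mult_left[of "- v"], of k sin] Suc by simp
  have "Ck (Suc k) (sin :: real \<Rightarrow> real)"
    using Ck_SucI[OF DERIV_sin[unfolded has_field_derivative_def] 1] .
  moreover have "Ck (Suc k) (cos :: real \<Rightarrow> real)"
    using Ck_SucI[OF DERIV_cos[unfolded has_field_derivative_def] 2] .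
  ultimately show ?case by blast
qed

lemma smooth_const: "smooth (\<lambda>_. c)"
  using Ck_const[of _ c] unfolding smooth_def by blast

lemma smooth_id: "smooth (\<lambda>x. x)"
  using Ck_id unfolding smooth_def by blast

lemma smooth_sin: "smooth (sin :: real \<Rightarrow> real)"
  using Ck_sin_cos unfolding smooth_def by blast

lemma smooth_add: "smooth F \<Longrightarrow> smooth G \<Longrightarrow> smooth (\<lambda>x. F x + G x)"
  using Ck_add[of _ F G] unfolding smooth_def by blast

lemma smooth_scaleR: "smooth f \<Longrightarrow> smooth G \<Longrightarrow> smooth (\<lambda>x. f x *\<^sub>R G x)"
  using Ck_scaleR[of _ f G] unfolding smooth_def by blast

lemma smooth_linear: "bounded_linear L \<Longrightarrow> smooth G \<Longrightarrow> smooth (\<lambda>x. L (G x))"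
  using Ck_linear[of L _ G] unfolding smooth_def by blast

lemma smooth_compose: "smooth F \<Longrightarrow> smooth G \<Longrightarrow> smooth (\<lambda>x. F (G x))"
  using Ck_compose[of _ F G] unfolding smooth_def by blast

lemma smooth_continuous: "smooth F \<Longrightarrow> continuous_on UNIV F"
  unfolding smooth_def using Ck_continuous by blast

lemma smooth_has_derivative: "smooth F \<Longrightarrow> (F has_derivative (\<lambda>v. dderiv v F x)) (at x)"
  unfolding smooth_def dderiv_def using Ck_SucD(1)[of 0] by blast

lemma smooth_dderiv: "smooth F \<Longrightarrow> smooth (dderiv v F)"
  unfolding smooth_def dderiv_def[abs_def] using Ck_SucD(2) by blast

lemma dderiv_eq: "(F has_derivative F') (at x) \<Longrightarrow> dderiv v F x = F' v"
  unfolding dderiv_def using frechet_derivative_at by metis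

definition ideriv :: "'a::euclidean_space list \<Rightarrow> ('a \<Rightarrow> 'b::euclidean_space) \<Rightarrow> 'a \<Rightarrow> 'b" where
  "ideriv vs F = foldr dderiv vs F"

lemma ideriv_simps [simp]: "ideriv [] F = F" "ideriv (v # vs) F = dderiv v (ideriv vs F)"
  by (simp_all add: ideriv_def)

lemma smooth_ideriv: "smooth F \<Longrightarrow> smooth (ideriv vs F)"
  by (induction vs) (auto intro: smooth_dderiv)

lemma dderiv_Basis:
  assumes "smooth F"
  shows "dderiv v F x = (\<Sum>b\<in>Basis. (v \<bullet> b) *\<^sub>R dderiv b F x)"
  by (rule linear_Basis_expand) (rule has_derivative_linear[OF smooth_has_derivative[OF assms]])

text \<open>If all iterated partial derivatives converge uniformly, the derivative of each limit is
  the limit of the derivatives. Indexing the limits by lists supplies every function that the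
  recursion of \<open>Ck\<close> descends to.\<close>

lemma smooth_limit:
  fixes F :: "nat \<Rightarrow> 'a::euclidean_space \<Rightarrow> 'b::euclidean_space"
  assumes sm: "\<And>n. smooth (F n)"
    and lim: "\<And>vs. set vs \<subseteq> Basis \<Longrightarrow> uniform_limit UNIV (\<lambda>n. ideriv vs (F n)) (L vs) sequentially"
  shows "smooth (L [])"
proof -
  have der: "(L vs has_derivative (\<lambda>v. \<Sum>b\<in>Basis. (v \<bullet> b) *\<^sub>R L (b # vs) x)) (at x)"
    if vs: "set vs \<subseteq> Basis" for vs x
  proof -
    let ?f' = "\<lambda>n x v. \<Sum>b\<in>Basis. (v \<bullet> b) *\<^sub>R ideriv (b # vs) (F n) x"
    let ?g' = "\<lambda>x v. \<Sum>b\<in>Basis. (v \<bullet> b) *\<^sub>R L (b # vs) x"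
    have "\<exists>g. \<forall>x\<in>UNIV. (\<lambda>n. ideriv vs (F n) x) \<longlonglongrightarrow> g x \<and> (g has_derivative ?g' x) (at x)"
    proof (rule has_derivative_sequence[where f' = ?f'])
      have "?f' n x = (\<lambda>v. dderiv v (ideriv vs (F n)) x)" for n x
        unfolding ideriv_simps by (rule ext, rule dderiv_Basis[symmetric], rule smooth_ideriv[OF sm])
      then show "(ideriv vs (F n) has_derivative ?f' n x) (at x)" for n x
        by (simp only: smooth_has_derivative[OF smooth_ideriv[OF sm]])
      show "(\<lambda>n. ideriv vs (F n) 0) \<longlonglongrightarrow> L vs 0"
        using tendsto_uniform_limitI[OF lim[OF vs]] by simp
      fix e :: real assume e: "e > 0"
      define d where "d = e / DIM('a)"
      have d: "d > 0" using e by (simp add: d_def)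
      have "\<forall>\<^sub>F n in sequentially. \<forall>b\<in>Basis. \<forall>x. dist (ideriv (b # vs) (F n) x) (L (b # vs) x) < d"
      proof (rule eventually_ball_finite[OF finite_Basis], intro ballI)
        fix b :: 'a assume "b \<in> Basis"
        then show "\<forall>\<^sub>F n in sequentially. \<forall>x. dist (ideriv (b # vs) (F n) x) (L (b # vs) x) < d"
          using uniform_limitD[OF lim[of "b # vs"] d] vs by simp
      qed
      then show "\<forall>\<^sub>F n in sequentially. \<forall>x\<in>UNIV. \<forall>h. norm (?f' n x h - ?g' x h) \<le> e * norm h"
      proof (rule eventually_mono, intro ballI allI)
        fix n x and h :: 'a
        assume *: "\<forall>b\<in>Basis. \<forall>x. dist (ideriv (b # vs) (F n) x) (L (b # vs) x) < d"
        have "?f' n x h - ?g' x h = (\<Sum>b\<in>Basis. (h \<bullet> b) *\<^sub>R (ideriv (b # vs) (F n) x - L (b # vs) x))"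
          by (simp add: sum_subtractf scaleR_diff_right)
        also have "norm \<dots> \<le> (\<Sum>b\<in>(Basis::'a set). norm h * d)"
        proof (rule sum_norm_le)
          fix b :: 'a assume b: "b \<in> Basis"
          show "norm ((h \<bullet> b) *\<^sub>R (ideriv (b # vs) (F n) x - L (b # vs) x)) \<le> norm h * d"
            unfolding norm_scaleR
            by (rule mult_mono) (use * b Basis_le_norm in \<open>auto simp: dist_norm less_imp_le\<close>)
        qed
        also have "\<dots> = e * norm h" by (simp add: d_def)
        finally show "norm (?f' n x h - ?g' x h) \<le> e * norm h" .
      qed
    qed auto
    then obtain g where g: "\<And>x. (\<lambda>n. ideriv vs (F n) x) \<longlonglongrightarrow> g x" "\<And>x. (g has_derivative ?g' x) (at x)"
      by auto
    have "g = L vs"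
      using g(1) tendsto_uniform_limitI[OF lim[OF vs]] LIMSEQ_unique by blast
    with g(2) show ?thesis by simp
  qed
  \<comment> \<open>The induction runs over all lists at once, because the partial derivatives of
    \<open>L vs\<close> are the functions \<open>L (b # vs)\<close>.\<close>
  have "Ck k (L vs)" if "set vs \<subseteq> Basis" for k vs
    using that
  proof (induction k arbitrary: vs)
    case 0
    then show ?case
      using der by (auto intro!: has_derivative_continuous_on simp: has_derivative_at_withinI)
  next
    case (Suc k)
    show ?case
      by (rule Ck_SucI[OF der[OF Suc.prems]], intro Ck_sum Ck_linear[OF bounded_linear_scaleR_right] Suc.IH)
        (use Suc.prems in auto)
  qed
  then show ?thesis unfolding smooth_def by simp
qed

section \<open>Lifts of torus maps\<close>

lemma int_lattice_scaleR: "x \<in> int_lattice \<Longrightarrow> real k *\<^sub>R x \<in> int_lattice"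
  by (simp add: int_lattice_def)

definition cube :: "(real ^ 'n) set" where
  "cube = {x. \<forall>i. 0 \<le> x $ i \<and> x $ i < 1}"

definition vfloor :: "real ^ 'n \<Rightarrow> real ^ 'n" where
  "vfloor x = (\<chi> i. of_int \<lfloor>x $ i\<rfloor>)"

lemma vfloor_in_lattice: "vfloor x \<in> int_lattice"
  by (simp add: vfloor_def int_lattice_def)

lemma diff_vfloor_in_cube: "x - vfloor x \<in> cube"
  by (simp add: vfloor_def cube_def frac_ge_0 frac_lt_1 flip: frac_def)

lemma cube_subset: "cube \<subseteq> cbox 0 1"
  by (auto simp: cube_def mem_box_cart less_imp_le)

definition equivariant :: "(real ^ 'n \<Rightarrow> real ^ 'n) \<Rightarrow> bool" where
  "equivariant F \<longleftrightarrow> (\<forall>x. \<forall>m\<in>int_lattice. F (x + m) = F x + m)"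

lemma equivariantD: "equivariant F \<Longrightarrow> m \<in> int_lattice \<Longrightarrow> F (x + m) = F x + m"
  by (simp add: equivariant_def)

lemma equivariantD_diff: "equivariant F \<Longrightarrow> m \<in> int_lattice \<Longrightarrow> F (x - m) = F x - m"
  using equivariantD[of F "- m" x] int_lattice_minus[of m] by simp

lemma equivariant_compose: "equivariant F \<Longrightarrow> equivariant G \<Longrightarrow> equivariant (\<lambda>x. F (G x))"
  by (simp add: equivariant_def)

lemma equivariant_translation: "equivariant F \<Longrightarrow> equivariant (\<lambda>x. F x + w)"
  by (simp add: equivariant_def)

text \<open>A lattice translation moves both points into one compact box without changing the
  difference of their images. The box exceeds the unit cube by 1 on each side because only the first
  point is brought into the cube.\<close>

lemma equivariant_uniformly_continuous:
  fixes F :: "real ^ 'n \<Rightarrow> real ^ 'n"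
  assumes "equivariant F" "continuous_on UNIV F" "\<epsilon> > 0"
  obtains \<delta> where "\<delta> > 0" "\<And>x y. norm (x - y) < \<delta> \<Longrightarrow> norm (F x - F y) < \<epsilon>"
proof -
  have "uniformly_continuous_on (cbox (-1) 2) F"
    by (intro compact_uniformly_continuous compact_cbox continuous_on_subset[OF assms(2)]) simp
  then obtain d where d: "d > 0"
    "\<And>x y. x \<in> cbox (-1) 2 \<Longrightarrow> y \<in> cbox (-1) 2 \<Longrightarrow> dist x y < d \<Longrightarrow> dist (F x) (F y) < \<epsilon>"
    unfolding uniformly_continuous_on_def using assms(3) by metis
  have "norm (F x - F y) < \<epsilon>" if xy: "norm (x - y) < min d 1" for x y
  proof -
    let ?m = "vfloor x"
    have x: "0 \<le> (x - ?m) $ i" "(x - ?m) $ i < 1" for i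
      using diff_vfloor_in_cube[of x] by (simp_all add: cube_def)
    have "\<bar>(x - y) $ i\<bar> < 1" for i
      using component_le_norm_cart[of "x - y" i] xy by simp
    then have "\<bar>x $ i - y $ i\<bar> < 1" for i by simp
    then have "x - ?m \<in> cbox (-1) 2" "y - ?m \<in> cbox (-1) 2"
      unfolding mem_box_cart using x by (auto simp: abs_less_iff) (smt (verit))+
    moreover have "dist (x - ?m) (y - ?m) < d" using xy by (simp add: dist_norm)
    ultimately have "dist (F (x - ?m)) (F (y - ?m)) < \<epsilon>" using d by blast
    then show ?thesis
      by (simp add: equivariantD_diff[OF assms(1) vfloor_in_lattice] dist_norm)
  qed
  then show thesis using that[of "min d 1"] d(1) by simp
qed

lemma ideriv_snoc: "ideriv (vs @ [v]) F = ideriv vs (dderiv v F)"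
  by (simp add: ideriv_def)

lemma dderiv_add_const: "smooth F \<Longrightarrow> dderiv v (\<lambda>x. F x + c) = dderiv v F"
  by (intro ext dderiv_eq) (auto intro!: derivative_eq_intros smooth_has_derivative)

lemma dderiv_shift:
  assumes "smooth F" shows "dderiv v (\<lambda>x. F (x + c)) = (\<lambda>x. dderiv v F (x + c))"
proof (intro ext dderiv_eq)
  fix x
  have "((\<lambda>x. x + c) has_derivative (\<lambda>v. v)) (at x)"
    by (auto intro!: derivative_eq_intros)
  from has_derivative_compose[OF this smooth_has_derivative[OF assms]]
  show "((\<lambda>x. F (x + c)) has_derivative (\<lambda>v. dderiv v F (x + c))) (at x)" .
qed

lemma ideriv_shift:
  assumes "smooth F" shows "ideriv vs (\<lambda>x. F (x + c)) = (\<lambda>x. ideriv vs F (x + c))"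
  by (induction vs) (simp_all add: dderiv_shift[OF smooth_ideriv[OF assms]])

text \<open>The displacement \<open>m\<close> is a constant, so the first differentiation removes
  it: all proper derivatives are periodic. That differentiation belongs to the last list entry,
  hence the case split from the right.\<close>

lemma ideriv_equivariant:
  assumes "smooth F" "equivariant F" "m \<in> int_lattice"
  shows "ideriv vs F (x + m) = ideriv vs F x + (if vs = [] then m else 0)"
proof (cases vs rule: rev_cases)
  case Nil
  then show ?thesis using assms by (simp add: equivariantD)
next
  case (snoc us u)
  have "ideriv vs F (x + m) = ideriv vs (\<lambda>x. F (x + m)) x"
    by (simp add: ideriv_shift[OF assms(1)])
  also have "\<dots> = ideriv vs (\<lambda>x. F x + m) x"
    by (simp only: equivariantD[OF assms(2,3)])
  also have "\<dots> = ideriv vs F x"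
    by (simp only: snoc ideriv_snoc dderiv_add_const[OF assms(1)])
  finally show ?thesis using snoc by simp
qed

text \<open>Derivatives of a slice become derivatives of one function of both variables, so that
  their dependence on the parameter \<open>w\<close> can be controlled by joint continuity.\<close>

lemma ideriv_slice:
  fixes \<Phi> :: "'a::euclidean_space \<times> 'b::euclidean_space \<Rightarrow> 'c::euclidean_space"
  assumes "smooth \<Phi>"
  shows "ideriv vs (\<lambda>x. \<Phi> (w, x)) = (\<lambda>x. ideriv (map (\<lambda>v. (0, v)) vs) \<Phi> (w, x))"
proof (induction vs)
  case (Cons v vs)
  let ?\<Psi> = "ideriv (map (\<lambda>v. (0, v)) vs) \<Phi>"
  have "dderiv v (\<lambda>x. ?\<Psi> (w, x)) = (\<lambda>x. dderiv (0, v) ?\<Psi> (w, x))"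
  proof (intro ext dderiv_eq)
    fix x :: 'b
    have "((\<lambda>x. (w, x)) has_derivative (\<lambda>v::'b. (0::'a, v))) (at x)"
      by (auto intro!: derivative_eq_intros)
    from has_derivative_compose[OF this, of ?\<Psi>, OF smooth_has_derivative[OF smooth_ideriv[OF assms]]]
    show "((\<lambda>x. ?\<Psi> (w, x)) has_derivative (\<lambda>v. dderiv (0, v) ?\<Psi> (w, x))) (at x)" .
  qed
  then show ?case by (simp add: Cons)
qed simp

section \<open>C^k closeness of conjugated translations\<close>

definition Ck_close :: "nat \<Rightarrow> real \<Rightarrow> (real ^ 'n \<Rightarrow> real ^ 'n) \<Rightarrow> (real ^ 'n \<Rightarrow> real ^ 'n) \<Rightarrow> bool" where
  "Ck_close n \<delta> F G \<longleftrightarrow>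
    (\<forall>vs x. set vs \<subseteq> Basis \<longrightarrow> length vs \<le> n \<longrightarrow> norm (ideriv vs F x - ideriv vs G x) \<le> \<delta>)"

text \<open>Each derivative is uniformly continuous on a compact set of pairs \<open>(w, x)\<close>.
  Equivariance reduces all \<open>x\<close> to the unit cube, and only finitely many lists of basis
  vectors have length at most \<open>n\<close>.\<close>

lemma Ck_close_family:
  fixes \<Phi> :: "(real ^ 'n) \<times> (real ^ 'n) \<Rightarrow> real ^ 'n"
  assumes sm: "smooth \<Phi>" and eq: "\<And>w. equivariant (\<lambda>x. \<Phi> (w, x))" and \<delta>: "\<delta> > 0"
  shows "\<forall>\<^sub>F w in nhds w0. Ck_close n \<delta> (\<lambda>x. \<Phi> (w, x)) (\<lambda>x. \<Phi> (w0, x))"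
proof -
  have sm': "smooth (\<lambda>x. \<Phi> (w, x))" for w
  proof -
    have "smooth (\<lambda>x. (w, 0) + (0, x))"
      by (intro smooth_add smooth_const smooth_linear[of "\<lambda>x. (0, x)", OF _ smooth_id])
        (simp add: bounded_linear_Pair bounded_linear_zero bounded_linear_ident)
    from smooth_compose[OF sm this] show ?thesis by simp
  qed
  have step: "\<forall>\<^sub>F w in nhds w0. \<forall>x. norm (ideriv vs (\<lambda>x. \<Phi> (w, x)) x - ideriv vs (\<lambda>x. \<Phi> (w0, x)) x) \<le> \<delta>" for vs
  proof -
    define \<Psi> where "\<Psi> = ideriv (map (\<lambda>v. (0, v)) vs) \<Phi>"
    have \<Psi>: "ideriv vs (\<lambda>x. \<Phi> (w, x)) x = \<Psi> (w, x)" for w x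
      by (simp add: ideriv_slice[OF sm] \<Psi>_def)
    have "continuous_on UNIV \<Psi>"
      unfolding \<Psi>_def by (intro smooth_continuous smooth_ideriv sm)
    then have "uniformly_continuous_on (cball w0 1 \<times> cbox 0 1) \<Psi>"
      by (intro compact_uniformly_continuous compact_Times compact_cbox compact_cball) 
        (erule continuous_on_subset, simp)
    then obtain d where d: "d > 0"
      "\<And>p q. p \<in> cball w0 1 \<times> cbox 0 1 \<Longrightarrow> q \<in> cball w0 1 \<times> cbox 0 1 \<Longrightarrow> dist p q < d \<Longrightarrow> dist (\<Psi> p) (\<Psi> q) < \<delta>"
      unfolding uniformly_continuous_on_def using \<delta> by metis
    have "norm (\<Psi> (w, x) - \<Psi> (w0, x)) \<le> \<delta>" if w: "dist w w0 < min d 1" for w x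
    proof -
      let ?y = "x - vfloor x"
      have y: "?y \<in> cbox 0 1" using diff_vfloor_in_cube cube_subset by blast
      have "dist (w, ?y) (w0, ?y) < d" using w by (simp add: dist_Pair_Pair)
      then have "dist (\<Psi> (w, ?y)) (\<Psi> (w0, ?y)) < \<delta>"
        using d(2)[of "(w, ?y)" "(w0, ?y)"] w y by (simp add: dist_commute)
      moreover have "\<Psi> (v, x) = \<Psi> (v, ?y) + (if vs = [] then vfloor x else 0)" for v
        using ideriv_equivariant[OF sm' eq vfloor_in_lattice[of x], of vs v ?y] by (simp add: \<Psi>)
      ultimately show ?thesis by (simp add: dist_norm)
    qed
    then show ?thesis
      unfolding eventually_nhds_metric \<Psi> using d(1) by (intro exI[of _ "min d 1"]) simp
  qed
  have "finite {vs. set vs \<subseteq> (Basis :: (real ^ 'n) set) \<and> length vs \<le> n}"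
    by (rule finite_lists_length_le) simp
  then have "\<forall>\<^sub>F w in nhds w0. \<forall>vs\<in>{vs. set vs \<subseteq> Basis \<and> length vs \<le> n}.
      \<forall>x. norm (ideriv vs (\<lambda>x. \<Phi> (w, x)) x - ideriv vs (\<lambda>x. \<Phi> (w0, x)) x) \<le> \<delta>"
    using step by (intro eventually_ball_finite) auto
  then show ?thesis
    by (rule eventually_mono) (auto simp: Ck_close_def)
qed

text \<open>\<open>K\<close> stands for the inverse of \<open>H\<close> and is carried along
  explicitly. The inverse of the conjugated translation is then obtained by replacing
  \<open>w\<close> by \<open>- w\<close>.\<close>

definition conj_translation ::
  "(real ^ 'n \<Rightarrow> real ^ 'n) \<Rightarrow> (real ^ 'n \<Rightarrow> real ^ 'n) \<Rightarrow> real ^ 'n \<Rightarrow> real ^ 'n \<Rightarrow> real ^ 'n" where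
  "conj_translation H K w x = H (K x + w)"

lemma Ck_close_conj_translation:
  assumes "smooth H" "smooth K" "equivariant H" "equivariant K" "\<delta> > 0"
  shows "\<forall>\<^sub>F w in nhds w0. Ck_close n \<delta> (conj_translation H K w) (conj_translation H K w0)"
proof -
  have 1: "smooth (\<lambda>p. H (K (snd p) + fst p))"
    by (intro smooth_compose[OF assms(1)] smooth_add smooth_compose[OF assms(2)]
        smooth_linear[OF bounded_linear_fst smooth_id] smooth_linear[OF bounded_linear_snd smooth_id])
  have 2: "equivariant (\<lambda>x. H (K (snd (w, x)) + fst (w, x)))" for w
    using equivariant_compose[OF assms(3) equivariant_translation[OF assms(4)]] by simp
  show ?thesis
    using Ck_close_family[OF 1 2 assms(5), of n w0] by (simp add: conj_translation_def[abs_def])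
qed

section \<open>Volume-preserving maps\<close>

definition volume_preserving :: "('a::euclidean_space \<Rightarrow> 'a) \<Rightarrow> bool" where
  "volume_preserving F \<longleftrightarrow> F \<in> borel_measurable borel \<and> distr lborel lborel F = lborel"

lemma volume_preserving_id: "volume_preserving (\<lambda>x. x)"
  by (simp add: volume_preserving_def distr_id2)

lemma volume_preserving_translation: "volume_preserving (\<lambda>x. x + w)"
  unfolding volume_preserving_def
proof
  show "distr lborel lborel (\<lambda>x. x + w) = lborel"
    using lborel_distr_plus[of w] by (simp add: add.commute cong: distr_cong)
qed simp

lemma volume_preserving_compose:
  assumes "volume_preserving F" "volume_preserving G"
  shows "volume_preserving (\<lambda>x. F (G x))"
proof -
  have [measurable]: "F \<in> borel_measurable borel" "G \<in> borel_measurable borel"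
    using assms by (simp_all add: volume_preserving_def)
  have "distr lborel lborel (F \<circ> G) = distr (distr lborel lborel G) lborel F"
    by (rule distr_distr[symmetric]) simp_all
  also have "\<dots> = lborel" using assms by (simp add: volume_preserving_def)
  finally show ?thesis by (simp add: volume_preserving_def comp_def)
qed

lemma volume_preserving_nn_integral:
  assumes "volume_preserving F" "u \<in> borel_measurable borel"
  shows "(\<integral>\<^sup>+ x. u (F x) \<partial>lborel) = (\<integral>\<^sup>+ x. u x \<partial>lborel)"
proof -
  have "(\<integral>\<^sup>+ x. u (F x) \<partial>lborel) = (\<integral>\<^sup>+ x. u x \<partial>distr lborel lborel F)"
    by (rule nn_integral_distr[symmetric]) (use assms in \<open>simp_all add: volume_preserving_def\<close>)
  then show ?thesis using assms by (simp add: volume_preserving_def)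
qed

section \<open>Shears preserve volume\<close>

definition shear :: "'n \<Rightarrow> 'n \<Rightarrow> (real \<Rightarrow> real) \<Rightarrow> real ^ 'n \<Rightarrow> real ^ 'n" where
  "shear i j \<phi> x = x + axis j (\<phi> (x $ i))"

lemma shear_component: "shear i j \<phi> x $ k = x $ k + (if k = j then \<phi> (x $ i) else 0)"
  by (simp add: shear_def axis_def)

lemma shear_inverse: "i \<noteq> j \<Longrightarrow> shear i j (\<lambda>t. - \<phi> t) (shear i j \<phi> x) = x"
  by (simp add: vec_eq_iff shear_component)

lemma shear_measurable [measurable]:
  fixes i j :: "'n::finite"
  assumes [measurable]: "\<phi> \<in> borel_measurable borel"
  shows "shear i j \<phi> \<in> borel_measurable borel"
proof -
  have "(\<lambda>x. x + axis j (\<phi> (x $ i))) = (\<lambda>x::real^'n. x + \<phi> (x $ i) *\<^sub>R axis j 1)"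
    by (simp add: fun_eq_iff vec_eq_iff axis_def)
  moreover have "(\<lambda>x::real^'n. x $ i) \<in> borel_measurable borel"
    by (intro borel_measurable_continuous_onI continuous_intros)
  ultimately show ?thesis unfolding shear_def[abs_def] by simp
qed

text \<open>By Fubini, integrate first in coordinate \<open>j\<close>. As
  \<open>i \<noteq> j\<close>, the shear is there a translation by a constant depending only on the
  other coordinates, and one-dimensional Lebesgue measure is translation invariant.\<close>

lemma volume_preserving_shear:
  fixes i j :: "'n::finite"
  assumes ij: "i \<noteq> j" and [measurable]: "\<phi> \<in> borel_measurable borel"
  shows "volume_preserving (shear i j \<phi>)"
proof -
  let ?B = "Basis :: (real ^ 'n) set" and ?a = "axis i 1 :: real ^ 'n" and ?b = "axis j 1 :: real ^ 'n"
  let ?v = "\<lambda>f. \<Sum>b\<in>?B. f b *\<^sub>R b" and ?I = "?B - {?b}"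
  interpret product_sigma_finite "\<lambda>_::real ^ 'n. lborel :: real measure" ..
  have b: "?b \<in> ?B" "?a \<in> ?I" using ij by (auto simp: axis_in_Basis_iff axis_eq_axis)
  have B: "insert ?b ?I = ?B" using b by auto
  \<comment> \<open>Lebesgue measure as a product over the basis, with coordinate \<open>j\<close>
    split off as the inner integral.\<close>
  have lb: "integral\<^sup>N lborel u = (\<integral>\<^sup>+ f. \<integral>\<^sup>+ y. u (?v (f(?b := y))) \<partial>lborel \<partial>PiM ?I (\<lambda>_. lborel))"
    if [measurable]: "u \<in> borel_measurable borel" for u :: "real ^ 'n \<Rightarrow> ennreal"
  proof -
    have "integral\<^sup>N lborel u = (\<integral>\<^sup>+ f. u (?v f) \<partial>PiM ?B (\<lambda>_. lborel))"
      by (subst lborel_eq) (simp add: nn_integral_distr)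
    also have "\<dots> = (\<integral>\<^sup>+ f. u (?v f) \<partial>PiM (insert ?b ?I) (\<lambda>_. lborel))"
      by (simp only: B)
    also have "\<dots> = (\<integral>\<^sup>+ f. \<integral>\<^sup>+ y. u (?v (f(?b := y))) \<partial>lborel \<partial>PiM ?I (\<lambda>_. lborel))"
      by (rule product_nn_integral_insert) (simp_all add: B)
    finally show ?thesis .
  qed
  have "emeasure (distr lborel lborel (shear i j \<phi>)) A = emeasure lborel A" if A[measurable]: "A \<in> sets borel" for A
  proof -
    let ?u = "indicator A :: real ^ 'n \<Rightarrow> ennreal"
    have sh: "shear i j \<phi> (?v (f(?b := y))) = ?v (f(?b := y + \<phi> (f ?a)))" for f y
    proof -
      have ij': "?v f $ k = f (axis k 1)" for f k
        using inner_sum_left_Basis[of "axis k 1 :: real ^ 'n" f] by (simp add: inner_axis axis_in_Basis_iff)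
      show ?thesis
        using ij by (intro vec_eq_iff[THEN iffD2] allI) (simp only: shear_component ij', simp add: axis_eq_axis)
    qed
    have "emeasure (distr lborel lborel (shear i j \<phi>)) A = (\<integral>\<^sup>+ x. ?u (shear i j \<phi> x) \<partial>lborel)"
      using nn_integral_distr[of "shear i j \<phi>" lborel lborel ?u] by simp
    also have "\<dots> = (\<integral>\<^sup>+ f. \<integral>\<^sup>+ y. ?u (?v (f(?b := y + \<phi> (f ?a)))) \<partial>lborel \<partial>PiM ?I (\<lambda>_. lborel))"
      by (subst lb) (simp_all only: sh, simp)
    also have "\<dots> = (\<integral>\<^sup>+ f. \<integral>\<^sup>+ y. ?u (?v (f(?b := y))) \<partial>lborel \<partial>PiM ?I (\<lambda>_. lborel))"
    proof (rule nn_integral_cong)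
      fix f assume "f \<in> space (PiM ?I (\<lambda>_. lborel :: real measure))"
      have "(\<lambda>y. f(?b := y)) \<in> lborel \<rightarrow>\<^sub>M PiM ?B (\<lambda>_. lborel :: real measure)"
        using measurable_component_update[OF \<open>f \<in> _\<close>, of ?b] B by simp
      from measurable_compose[OF this, of "\<lambda>f. ?u (?v f)" borel]
      have [measurable]: "(\<lambda>y. ?u (?v (f(?b := y)))) \<in> borel_measurable borel"
        by simp
      show "(\<integral>\<^sup>+ y. ?u (?v (f(?b := y + \<phi> (f ?a)))) \<partial>lborel) = (\<integral>\<^sup>+ y. ?u (?v (f(?b := y))) \<partial>lborel)"
        using nn_integral_real_affine[of "\<lambda>y. ?u (?v (f(?b := y)))" 1 "\<phi> (f ?a)"] by (simp add: add.commute)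
    qed
    also have "\<dots> = emeasure lborel A" by (subst lb[symmetric]) simp_all
    finally show ?thesis .
  qed
  then have "distr lborel lborel (shear i j \<phi>) = lborel"
    by (intro measure_eqI) simp_all
  then show ?thesis by (simp add: volume_preserving_def)
qed

section \<open>Limits of volume-preserving maps\<close>

text \<open>
  By Fatou's lemma, a pointwise limit of volume-preserving maps does not increase the measure of
  open sets under preimages; applied to the inverse as well, this gives equality.
\<close>

lemma volume_preserving_limit_open:
  assumes vp: "\<And>n. volume_preserving (F n)" and lim: "\<And>x. (\<lambda>n. F n x) \<longlonglongrightarrow> G x" and U: "open U"
    and G: "G \<in> borel_measurable borel"
  shows "emeasure lborel (G -` U) \<le> emeasure lborel U"
proof -
  have [measurable]: "F n \<in> borel_measurable borel" "U \<in> sets borel" "G \<in> borel_measurable borel" for n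
    using vp U G by (simp_all add: volume_preserving_def)
  have "(indicator U (G x) :: ennreal) \<le> liminf (\<lambda>n. indicator U (F n x))" for x
  proof (cases "G x \<in> U")
    case True
    then have "\<forall>\<^sub>F n in sequentially. F n x \<in> U"
      by (rule topological_tendstoD[OF lim U])
    then show ?thesis
      by (intro Liminf_bounded) (auto elim!: eventually_mono simp: indicator_def)
  qed simp
  then have "(\<integral>\<^sup>+ x. indicator U (G x) \<partial>lborel) \<le> (\<integral>\<^sup>+ x. liminf (\<lambda>n. indicator U (F n x)) \<partial>lborel)"
    by (intro nn_integral_mono)
  also have "\<dots> \<le> liminf (\<lambda>n. \<integral>\<^sup>+ x. indicator U (F n x) \<partial>lborel)"
    by (rule nn_integral_liminf) simp
  also have "(\<lambda>n. \<integral>\<^sup>+ x. indicator U (F n x) \<partial>lborel) = (\<lambda>n. emeasure lborel U)"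
    using volume_preserving_nn_integral[OF vp, of "indicator U"] by simp
  also have "(\<integral>\<^sup>+ x. indicator U (G x) \<partial>lborel) = emeasure lborel (G -` U)"
  proof -
    have "(\<lambda>x. indicator U (G x)) = (indicator (G -` U) :: _ \<Rightarrow> ennreal)"
      by (auto simp: indicator_def fun_eq_iff)
    moreover have "G -` U \<in> sets lborel" using measurable_sets_borel[OF G, of U] by simp
    ultimately show ?thesis by simp
  qed
  finally show ?thesis by (simp add: Liminf_const)
qed

lemma volume_preserving_limit:
  assumes "\<And>n. volume_preserving (F n)" "\<And>x. (\<lambda>n. F n x) \<longlonglongrightarrow> F' x" "continuous_on UNIV F'"
    and "\<And>n. volume_preserving (G n)" "\<And>x. (\<lambda>n. G n x) \<longlonglongrightarrow> G' x" "continuous_on UNIV G'"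
    and inv: "\<And>x. F' (G' x) = x" "\<And>x. G' (F' x) = x"
  shows "volume_preserving F'"
proof -
  have [measurable]: "F' \<in> borel_measurable borel" "G' \<in> borel_measurable borel"
    using assms by (auto intro: borel_measurable_continuous_onI)
  have eq: "emeasure lborel (F' -` U) = emeasure lborel U" if U: "open U" for U
  proof (rule antisym)
    show "emeasure lborel (F' -` U) \<le> emeasure lborel U"
      by (rule volume_preserving_limit_open[OF assms(1,2) U]) simp
    have "G' -` (F' -` U) = U" using inv by auto
    moreover have "emeasure lborel (G' -` (F' -` U)) \<le> emeasure lborel (F' -` U)"
      by (rule volume_preserving_limit_open[OF assms(4,5) open_vimage[OF U assms(3)]]) simp
    ultimately show "emeasure lborel U \<le> emeasure lborel (F' -` U)" by simp
  qed
  \<comment> \<open>Lebesgue measure is characterised by its values on open boxes, so agreement on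
    open sets suffices.\<close>
  have "lborel = distr lborel borel F'"
  proof (rule lborel_eqI)
    fix l u :: 'a assume "\<And>b. b \<in> Basis \<Longrightarrow> l \<bullet> b \<le> u \<bullet> b"
    then show "emeasure (distr lborel borel F') (box l u) = ennreal (\<Prod>b\<in>Basis. (u - l) \<bullet> b)"
      by (simp add: emeasure_distr eq open_box)
  qed simp
  then show ?thesis
    unfolding volume_preserving_def by (simp cong: distr_cong)
qed

section \<open>Maps of the torus induced by equivariant maps\<close>

lemma torus_proj_rep: "torus_proj (rep_torus z) = z"
  by (rule Quotient_abs_rep[OF Quotient_torus])

lemma torus_cases: obtains x where "z = torus_proj x"
  using torus_proj_rep by metis

lemma torus_proj_add: "torus_proj (x + y) = torus_proj x + torus_proj y"
  by (simp add: plus_torus.abs_eq)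

lemma torus_proj_eqD:
  assumes "torus_proj x = torus_proj y"
  obtains m where "m \<in> int_lattice" "x = y + m"
  using assms that[of "x - y"] by (simp add: torus_proj_eq_iff)

lemma torus_proj_add_lattice: "m \<in> int_lattice \<Longrightarrow> torus_proj (x + m) = torus_proj x"
  by (simp add: torus_proj_eq_iff)

text \<open>The preimage of the image is the union of all lattice translates of \<open>S\<close>,
  which are open.\<close>

lemma open_image_torus_proj:
  assumes "open S"
  shows "open (torus_proj ` S)"
proof -
  have "torus_proj -` torus_proj ` S = (\<Union>m\<in>int_lattice. (+) m ` S)"
  proof (intro set_eqI iffI)
    fix x assume "x \<in> torus_proj -` torus_proj ` S"
    then obtain y where y: "y \<in> S" "torus_proj x = torus_proj y" by auto
    then obtain m where "m \<in> int_lattice" "x = m + y" by (metis torus_proj_eqD add.commute)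
    then show "x \<in> (\<Union>m\<in>int_lattice. (+) m ` S)" using y by auto
  next
    fix x assume "x \<in> (\<Union>m\<in>int_lattice. (+) m ` S)"
    then obtain m y where "m \<in> int_lattice" "y \<in> S" "x = y + m" by (auto simp: add.commute)
    then show "x \<in> torus_proj -` torus_proj ` S" by (auto simp: torus_proj_add_lattice)
  qed
  then show ?thesis
    using assms by (simp add: open_torus_def open_translation open_UN)
qed

lemma open_vimage_torus_proj: "open U \<Longrightarrow> open (torus_proj -` U)"
  by (simp add: open_torus_def)

lemma closed_int_lattice: "closed (int_lattice :: (real ^ 'n) set)"
proof -
  have "closed {x :: real ^ 'n. x $ i \<in> \<int>}" for i
    using closed_vimage[of "\<int> :: real set" "\<lambda>x :: real ^ 'n. x $ i"]
    by (simp add: closed_Ints vimage_def continuous_intros)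
  then show ?thesis unfolding int_lattice_def by (rule closed_Collect_all)
qed

text \<open>Since the lattice is closed, the difference of two inequivalent points has a ball of
  some radius \<open>e\<close> around it that avoids the lattice; the images of the balls of radius
  \<open>e / 2\<close> are then disjoint. This makes limits in the torus unique.\<close>

instance torus :: (finite) t2_space
proof
  fix x y :: "'a torus"
  assume "x \<noteq> y"
  obtain a where x: "x = torus_proj a" by (rule torus_cases)
  obtain b where y: "y = torus_proj b" by (rule torus_cases)
  have "a - b \<in> - int_lattice" using \<open>x \<noteq> y\<close> by (simp add: x y torus_proj_eq_iff)
  then obtain e where e: "e > 0" "ball (a - b) e \<subseteq> - int_lattice"
    using closed_int_lattice open_Compl open_contains_ball by metis
  let ?U = "torus_proj ` ball a (e / 2)" and ?V = "torus_proj ` ball b (e / 2)"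
  have "?U \<inter> ?V = {}"
  proof (rule ccontr)
    assume "?U \<inter> ?V \<noteq> {}"
    then obtain c d where cd: "c \<in> ball a (e / 2)" "d \<in> ball b (e / 2)" "torus_proj c = torus_proj d"
      by auto
    have "norm ((a - b) - (c - d)) \<le> norm (a - c) + norm (b - d)"
      using norm_triangle_ineq4[of "a - c" "b - d"] by (simp add: algebra_simps)
    then have "c - d \<in> ball (a - b) e"
      using cd by (simp add: dist_norm)
    then have "c - d \<in> - int_lattice" using e(2) by blast
    then show False using cd(3) by (simp add: torus_proj_eq_iff)
  qed
  moreover have "x \<in> ?U" "y \<in> ?V" using e by (simp_all add: x y)
  moreover have "open ?U" "open ?V" by (simp_all add: open_image_torus_proj)
  ultimately show "\<exists>U V. open U \<and> open V \<and> x \<in> U \<and> y \<in> V \<and> U \<inter> V = {}" by blast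
qed

text \<open>The chosen representative is arbitrary; the value does not depend on it when
  \<open>F\<close> is equivariant.\<close>

definition torus_map :: "(real ^ 'n \<Rightarrow> real ^ 'n) \<Rightarrow> 'n::finite torus \<Rightarrow> 'n torus" where
  "torus_map F z = torus_proj (F (rep_torus z))"

lemma torus_map_proj:
  assumes "equivariant F"
  shows "torus_map F (torus_proj x) = torus_proj (F x)"
proof -
  obtain m where "m \<in> int_lattice" "rep_torus (torus_proj x) = x + m"
    using torus_proj_rep torus_proj_eqD by metis
  then show ?thesis
    by (simp add: torus_map_def equivariantD[OF assms] torus_proj_add_lattice)
qed

lemma torus_map_funpow:
  assumes "equivariant F"
  shows "(torus_map F ^^ n) (torus_proj x) = torus_proj ((F ^^ n) x)"
  by (induction n) (simp_all add: torus_map_proj[OF assms])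

lemma continuous_torus_map:
  assumes "equivariant F" "continuous_on UNIV F"
  shows "continuous_on UNIV (torus_map F)"
proof -
  have "open (torus_map F -` U)" if "open U" for U
  proof -
    have "torus_proj -` torus_map F -` U = F -` torus_proj -` U"
      by (auto simp: torus_map_proj[OF assms(1)])
    then show ?thesis
      unfolding open_torus_def using open_vimage[OF open_vimage_torus_proj[OF that] assms(2)] by simp
  qed
  then show ?thesis by (simp add: continuous_on_open_vimage)
qed

lemma is_lift_torus_map: "equivariant F \<Longrightarrow> continuous_on UNIV F \<Longrightarrow> is_lift (torus_map F) F"
  by (simp add: is_lift_def torus_map_proj)

lemma torus_map_inverse:
  assumes "equivariant F" "equivariant G" "\<And>x. F (G x) = x"
  shows "torus_map F (torus_map G z) = z"
  by (rule torus_cases[of z]) (simp add: torus_map_proj assms)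

lemma smooth_torus_diffeo_torus_map:
  assumes "smooth F" "smooth G" "equivariant F" "equivariant G" "\<And>x. F (G x) = x" "\<And>x. G (F x) = x"
  shows "smooth_torus_diffeo (torus_map F)"
proof -
  have FG: "torus_map F (torus_map G z) = z" "torus_map G (torus_map F z) = z" for z
    using torus_map_inverse assms by blast+
  then have "bij (torus_map F)" by (metis bijI')
  moreover have "inv (torus_map F) = torus_map G"
    using FG by (intro inv_equality) auto
  moreover have "smooth_torus_map (torus_map F)" "smooth_torus_map (torus_map G)"
    unfolding smooth_torus_map_def using assms is_lift_torus_map smooth_continuous
    unfolding smooth_def by blast+
  ultimately show ?thesis by (simp add: smooth_torus_diffeo_def)
qed

section \<open>Lebesgue measure on the torus\<close>

lemma countable_int_lattice: "countable (int_lattice :: (real ^ 'n) set)"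
proof -
  have "int_lattice \<subseteq> range (\<lambda>f :: 'n \<Rightarrow> int. \<chi> i. of_int (f i))"
  proof
    fix m :: "real ^ 'n" assume "m \<in> int_lattice"
    then have "m = (\<chi> i. of_int \<lfloor>m $ i\<rfloor>)" by (simp add: int_lattice_def vec_eq_iff)
    then show "m \<in> range (\<lambda>f :: 'n \<Rightarrow> int. \<chi> i. of_int (f i))"
      by (rule range_eqI[of _ _ "\<lambda>i. \<lfloor>m $ i\<rfloor>"])
  qed
  moreover have "countable (UNIV :: ('n \<Rightarrow> int) set)"
    using countable_PiE[of "UNIV :: 'n set" "\<lambda>_. UNIV :: int set"] by (simp add: PiE_def extensional_def)
  ultimately show ?thesis by (meson countable_image countable_subset)
qed

lemma cube_borel [measurable]: "(cube :: (real ^ 'n) set) \<in> sets borel"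
proof -
  have "(cube :: (real ^ 'n) set) = (\<Inter>i. {x :: real ^ 'n. 0 \<le> x $ i} \<inter> {x. x $ i < 1})" by (auto simp: cube_def)
  moreover have "{x :: real ^ 'n. 0 \<le> x $ i} \<in> sets borel" "{x :: real ^ 'n. x $ i < 1} \<in> sets borel" for i
    by (intro borel_closed borel_open closed_Collect_le open_Collect_less continuous_intros)+
  then have "(\<Inter>i. {x :: real ^ 'n. 0 \<le> x $ i} \<inter> {x. x $ i < 1}) \<in> sets borel"
    by (intro sets.finite_INT sets.Int) auto
  ultimately show ?thesis by argo
qed

lemma cube_lattice_unique:
  assumes "x + m \<in> cube" "x + m' \<in> cube" "m \<in> int_lattice" "m' \<in> int_lattice"
  shows "m = m'"
proof -
  have "m $ i = m' $ i" for i
  proof -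
    obtain a b where "m $ i = of_int a" "m' $ i = of_int b"
      using assms(3,4) unfolding int_lattice_def mem_Collect_eq by (meson Ints_cases)
    moreover have "0 \<le> x $ i + m $ i" "x $ i + m $ i < 1" "0 \<le> x $ i + m' $ i" "x $ i + m' $ i < 1"
      using assms(1,2) by (auto simp: cube_def)
    ultimately have "real_of_int a < real_of_int b + 1" "real_of_int b < real_of_int a + 1" by linarith+
    then have "a = b" by linarith
    then show ?thesis by (simp add: \<open>m $ i = _\<close> \<open>m' $ i = _\<close>)
  qed
  then show ?thesis by (simp add: vec_eq_iff)
qed

text \<open>The lattice translates of the half-open cube tile the space, so exactly one
  \<open>m\<close>, namely \<open>- vfloor x\<close>, contributes. Inserting this sum as a factor 1
  cuts a domain along the tiles.\<close>

lemma nn_integral_lattice_cube: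
  "(\<integral>\<^sup>+ m. indicator cube (x + m) \<partial>count_space int_lattice) = 1"
proof -
  let ?m = "- vfloor x"
  have m: "?m \<in> int_lattice" "x + ?m \<in> cube"
    using vfloor_in_lattice int_lattice_minus diff_vfloor_in_cube[of x] by (auto simp del: add_uminus_conv_diff simp: diff_conv_add_uminus)
  have "(\<integral>\<^sup>+ m. indicator cube (x + m) \<partial>count_space int_lattice) = (\<integral>\<^sup>+ m. indicator {?m} m \<partial>count_space int_lattice)"
    using cube_lattice_unique[OF m(2) _ m(1)] m(2) by (intro nn_integral_cong) (auto simp: indicator_def)
  also have "\<dots> = 1" using m(1) by (subst nn_integral_indicator) simp_all
  finally show ?thesis .
qed

lemma torus_proj_borel [measurable]: "torus_proj \<in> borel_measurable borel"
  by (rule borel_measurable_continuous_onI[OF continuous_on_torus_proj])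

lemma sets_torus_lebesgue [simp]: "sets torus_lebesgue = sets borel"
  by (simp add: torus_lebesgue_def)

lemma space_torus_lebesgue [simp]: "space torus_lebesgue = UNIV"
  using sets_eq_imp_space_eq[OF sets_torus_lebesgue] by simp

lemma emeasure_torus_lebesgue:
  assumes [measurable]: "A \<in> sets borel"
  shows "emeasure torus_lebesgue A = emeasure lborel (torus_proj -` A \<inter> cube)"
proof -
  have "emeasure torus_lebesgue A = emeasure (restrict_space lborel cube) (torus_proj -` A \<inter> space (restrict_space lborel cube))"
    unfolding torus_lebesgue_def cube_def[symmetric] by (rule emeasure_distr[OF measurable_torus_proj]) simp
  also have "\<dots> = emeasure lborel (torus_proj -` A \<inter> cube)"
    by (subst emeasure_restrict_space) (auto simp: space_restrict_space)
  finally show ?thesis .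
qed

text \<open>
  The image of the unit cube under \<open>F\<close> is another fundamental domain; its pieces in the lattice
  translates of the cube are moved back into the cube one by one.
\<close>

lemma lebesgue_preserving_torus_map:
  fixes F G :: "real ^ 'n \<Rightarrow> real ^ 'n"
  assumes vp: "volume_preserving F" and G[measurable]: "G \<in> borel_measurable borel"
    and eq: "equivariant F" "equivariant G" and cont: "continuous_on UNIV F"
    and inv: "\<And>x. G (F x) = x"
  shows "lebesgue_preserving (torus_map F)"
proof -
  have m: "torus_map F \<in> borel_measurable borel"
    by (rule borel_measurable_continuous_onI[OF continuous_torus_map[OF eq(1) cont]])
  have [measurable]: "F \<in> borel_measurable borel" using vp by (simp add: volume_preserving_def)
  have "emeasure torus_lebesgue (torus_map F -` A) = emeasure torus_lebesgue A" if A: "A \<in> sets borel" for A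
  proof -
    define P where "P = torus_proj -` A"
    have P[measurable]: "P \<in> sets borel"
      using measurable_sets_borel[OF torus_proj_borel A] by (simp add: P_def)
    have P_add: "y + m \<in> P \<longleftrightarrow> y \<in> P" if "m \<in> int_lattice" for y m
      by (simp add: P_def torus_proj_add_lattice[OF that])
    let ?c = "indicator cube :: real ^ 'n \<Rightarrow> ennreal" and ?p = "indicator P :: real ^ 'n \<Rightarrow> ennreal"
    let ?L = "count_space int_lattice :: (real ^ 'n) measure"
    have "emeasure torus_lebesgue (torus_map F -` A) = emeasure lborel (torus_proj -` torus_map F -` A \<inter> cube)"
      using measurable_sets_borel[OF m A] by (rule emeasure_torus_lebesgue)
    also have "torus_proj -` torus_map F -` A = F -` P"
      by (auto simp: P_def torus_map_proj[OF eq(1)])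
    also have "emeasure lborel (F -` P \<inter> cube) = (\<integral>\<^sup>+ x. ?c x * ?p (F x) \<partial>lborel)"
    proof -
      have "F -` P \<inter> cube \<in> sets lborel" using measurable_sets_borel[OF _ P, of F] by simp
      then have "emeasure lborel (F -` P \<inter> cube) = (\<integral>\<^sup>+ x. indicator (F -` P \<inter> cube) x \<partial>lborel)" by simp
      also have "\<dots> = (\<integral>\<^sup>+ x. ?c x * ?p (F x) \<partial>lborel)"
        by (intro nn_integral_cong) (auto simp: indicator_def)
      finally show ?thesis .
    qed
    also have "\<dots> = (\<integral>\<^sup>+ y. ?c (G y) * ?p y \<partial>lborel)"
      using volume_preserving_nn_integral[OF vp, where u = "\<lambda>y. ?c (G y) * ?p y"] by (simp add: inv)
    \<comment> \<open>The factor 1 is inserted as the sum of \<open>?c (y + m)\<close> over the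
      lattice.\<close>
    also have "\<dots> = (\<integral>\<^sup>+ y. \<integral>\<^sup>+ m. ?c (G y) * ?p y * ?c (y + m) \<partial>?L \<partial>lborel)"
      by (subst nn_integral_cmult) (simp_all add: nn_integral_lattice_cube)
    also have "\<dots> = (\<integral>\<^sup>+ m. \<integral>\<^sup>+ y. ?c (G y) * ?p y * ?c (y + m) \<partial>lborel \<partial>?L)"
      by (rule nn_integral_count_space_nn_integral[OF countable_int_lattice]) simp
    \<comment> \<open>Translation by \<open>m\<close> moves each piece into the unit cube;
      \<open>P\<close> is invariant under it, and \<open>G\<close> picks up the shift by
      equivariance.\<close>
    also have "\<dots> = (\<integral>\<^sup>+ m. \<integral>\<^sup>+ y. ?c y * ?p y * ?c (G y + (- m)) \<partial>lborel \<partial>?L)"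
    proof (rule nn_integral_cong)
      fix m assume "m \<in> space ?L"
      then have m: "m \<in> int_lattice" by simp
      have "(\<integral>\<^sup>+ y. ?c y * ?p y * ?c (G y + (- m)) \<partial>lborel) =
          (\<integral>\<^sup>+ y. ?c (y + m) * ?p (y + m) * ?c (G (y + m) + (- m)) \<partial>lborel)"
        by (rule volume_preserving_nn_integral[OF volume_preserving_translation, symmetric]) simp
      also have "\<dots> = (\<integral>\<^sup>+ y. ?c (G y) * ?p y * ?c (y + m) \<partial>lborel)"
        by (intro nn_integral_cong)
          (simp add: equivariantD[OF eq(2) m] P_add[OF m] indicator_def)
      finally show "(\<integral>\<^sup>+ y. ?c (G y) * ?p y * ?c (y + m) \<partial>lborel) =
        (\<integral>\<^sup>+ y. ?c y * ?p y * ?c (G y + (- m)) \<partial>lborel)" by simp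
    qed
    \<comment> \<open>After reindexing by \<open>- m\<close>, the sum of \<open>?c (G y + m)\<close>
      is again 1 and disappears.\<close>
    also have "\<dots> = (\<integral>\<^sup>+ m. \<integral>\<^sup>+ y. ?c y * ?p y * ?c (G y + m) \<partial>lborel \<partial>?L)"
    proof -
      have "bij_betw uminus int_lattice (int_lattice :: (real ^ 'n) set)"
        by (rule bij_betwI[of _ _ _ uminus]) (auto simp: int_lattice_minus)
      from nn_integral_bij_count_space[OF this, of "\<lambda>m. \<integral>\<^sup>+ y. ?c y * ?p y * ?c (G y + m) \<partial>lborel"]
      show ?thesis .
    qed
    also have "\<dots> = (\<integral>\<^sup>+ y. \<integral>\<^sup>+ m. ?c y * ?p y * ?c (G y + m) \<partial>?L \<partial>lborel)"
      by (rule nn_integral_count_space_nn_integral[OF countable_int_lattice, symmetric]) simp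
    also have "\<dots> = (\<integral>\<^sup>+ y. ?c y * ?p y \<partial>lborel)"
      by (subst nn_integral_cmult) (simp_all add: nn_integral_lattice_cube)
    also have "\<dots> = (\<integral>\<^sup>+ y. indicator (P \<inter> cube) y \<partial>lborel)"
      by (intro nn_integral_cong) (auto simp: indicator_def)
    also have "\<dots> = emeasure torus_lebesgue A"
      by (simp add: emeasure_torus_lebesgue[OF A] P_def[symmetric])
    finally show ?thesis .
  qed
  then have "distr torus_lebesgue torus_lebesgue (torus_map F) = torus_lebesgue"
    using m by (intro measure_eqI) (simp_all add: emeasure_distr space_torus_lebesgue cong: measurable_cong_sets)
  then show ?thesis
    using m by (simp add: lebesgue_preserving_def cong: measurable_cong_sets)
qed

section \<open>Dynamics of the induced maps\<close>

text \<open>The bound \<open>N\<close> is uniform in both points, so finitely many iterates decide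
  the property and it survives small uniform perturbations at a slightly larger scale.\<close>

definition orbit_dense :: "real \<Rightarrow> (real ^ 'n \<Rightarrow> real ^ 'n) \<Rightarrow> bool" where
  "orbit_dense \<epsilon> F \<longleftrightarrow>
    (\<exists>N. \<forall>x y. \<exists>k\<le>N. \<exists>m\<in>int_lattice. norm ((F ^^ k) x - y - m) < \<epsilon>)"

lemma minimal_torus_map:
  assumes eq: "equivariant F" and dense: "\<And>\<epsilon>. \<epsilon> > 0 \<Longrightarrow> orbit_dense \<epsilon> F"
  shows "minimal_map (torus_map F)"
  unfolding minimal_map_def
proof (intro allI set_eqI iffI)
  fix z y :: "'a torus"
  obtain a where z: "z = torus_proj a" by (rule torus_cases)
  obtain b where y: "y = torus_proj b" by (rule torus_cases)
  show "y \<in> closure (range (\<lambda>n. (torus_map F ^^ n) z))"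
    unfolding closure_iff_nhds_not_empty
  proof (intro allI impI)
    fix A U assume "U \<subseteq> A" "open U" "y \<in> U"
    then have "open (torus_proj -` U)" "b \<in> torus_proj -` U"
      by (simp_all add: open_vimage_torus_proj y)
    then obtain e where e: "e > 0" "ball b e \<subseteq> torus_proj -` U" by (meson open_contains_ball)
    obtain k m where km: "m \<in> int_lattice" "norm ((F ^^ k) a - b - m) < e"
      using dense[OF e(1)] unfolding orbit_dense_def by metis
    have "(F ^^ k) a - m \<in> ball b e"
      using km(2) by (simp add: dist_norm norm_minus_commute algebra_simps)
    then have "torus_proj ((F ^^ k) a - m) \<in> U" using e(2) by blast
    moreover have "torus_proj ((F ^^ k) a - m) = (torus_map F ^^ k) z"
      using torus_proj_add_lattice[OF int_lattice_minus[OF km(1)], of "(F ^^ k) a"]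
      by (simp add: z torus_map_funpow[OF eq])
    ultimately show "range (\<lambda>n. (torus_map F ^^ n) z) \<inter> A \<noteq> {}" using \<open>U \<subseteq> A\<close> by auto
  qed
qed simp

text \<open>If this holds for every \<open>\<epsilon>\<close>, the projections of \<open>p\<close>
  and \<open>q\<close> are a proximal pair or equal. Distances are measured between the lifted
  orbits themselves, without correction by lattice vectors.\<close>

definition near_collision :: "real ^ 'n \<Rightarrow> real ^ 'n \<Rightarrow> real \<Rightarrow> (real ^ 'n \<Rightarrow> real ^ 'n) \<Rightarrow> bool" where
  "near_collision p q \<epsilon> F \<longleftrightarrow> (\<exists>k. norm ((F ^^ k) p - (F ^^ k) q) < \<epsilon>)"

lemma torus_plus_continuous: "continuous_on UNIV (\<lambda>z :: 'n::finite torus. z + c)"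
proof -
  have "continuous_on UNIV (torus_map (\<lambda>x :: real ^ 'n. x + rep_torus c))"
    by (intro continuous_torus_map equivariant_translation continuous_intros) (simp add: equivariant_def)
  moreover have "torus_map (\<lambda>x. x + rep_torus c) = (\<lambda>z. z + c)"
    by (simp add: fun_eq_iff torus_map_def torus_proj_add torus_proj_rep)
  ultimately show ?thesis by simp
qed

text \<open>
  Translations are distal: the difference of two points is constant along their orbits. Hence a
  map conjugate to a translation has no proximal pairs.
\<close>

lemma not_conj_to_translation_torus_map:
  fixes F :: "real ^ 'n \<Rightarrow> real ^ 'n"
  assumes eq: "equivariant F" and pq: "p - q \<notin> int_lattice"
    and coll: "\<And>\<epsilon>. \<epsilon> > 0 \<Longrightarrow> near_collision p q \<epsilon> F"
  shows "\<not> conj_to_translation (torus_map F)"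
proof
  assume "conj_to_translation (torus_map F)"
  then obtain v and h g :: "'n torus \<Rightarrow> 'n torus" where hg: "homeomorphism UNIV UNIV h g"
    and conj: "h \<circ> torus_map F = torus_translation v \<circ> h"
    unfolding conj_to_translation_def by blast
  have conth: "continuous_on UNIV h" and "inj h"
    using hg unfolding homeomorphism_def by (auto intro: inj_on_inverseI)
  have step: "h (torus_map F z) = h z + v" for z
    using fun_cong[OF conj, of z] by (simp add: torus_translation_def)
  have diff: "h ((torus_map F ^^ k) z) = h ((torus_map F ^^ k) z') + (h z - h z')" for k z z'
    by (induction k) (simp_all add: step algebra_simps)
  define c where "c = h (torus_proj p) - h (torus_proj q)"
  have "c \<noteq> 0"
    using \<open>inj h\<close> pq by (simp add: c_def inj_eq torus_proj_eq_iff)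
  have "\<exists>k. norm ((F ^^ k) p - (F ^^ k) q) < 1 / real (Suc n)" for n
    using coll[of "1 / real (Suc n)"] by (simp add: near_collision_def)
  then obtain k where k: "\<And>n. norm ((F ^^ k n) p - (F ^^ k n) q) < 1 / real (Suc n)" by metis
  \<comment> \<open>Both orbits are shifted by the same lattice vector: \<open>x n\<close> lands in
    a compact cube, and \<open>y n\<close> remains close to \<open>x n\<close>.\<close>
  define x where "x n = (F ^^ k n) p - vfloor ((F ^^ k n) p)" for n
  define y where "y n = (F ^^ k n) q - vfloor ((F ^^ k n) p)" for n
  have "x n \<in> cbox 0 1" for n
    using diff_vfloor_in_cube cube_subset unfolding x_def by blast
  then obtain u r where u: "strict_mono r" "(x \<circ> r) \<longlonglongrightarrow> u"
    using compact_cbox[of 0 1] unfolding compact_def by blast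
  have "norm (y n - x n) \<le> 1 / real (Suc n)" for n
    using k[of n] by (simp add: x_def y_def norm_minus_commute)
  then have "(\<lambda>n. y n - x n) \<longlonglongrightarrow> 0"
    by (intro Lim_null_comparison[OF _ LIMSEQ_Suc[OF lim_1_over_n]]) simp
  then have "(\<lambda>n. (y \<circ> r) n - (x \<circ> r) n) \<longlonglongrightarrow> 0"
    using LIMSEQ_subseq_LIMSEQ[OF _ u(1)] by (fastforce simp: comp_def)
  from tendsto_add[OF u(2) this] have y: "(y \<circ> r) \<longlonglongrightarrow> u" by (simp add: comp_def)
  have proj: "torus_proj (x n) = (torus_map F ^^ k n) (torus_proj p)"
    "torus_proj (y n) = (torus_map F ^^ k n) (torus_proj q)" for n
    unfolding x_def y_def torus_map_funpow[OF eq]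
    using torus_proj_add_lattice[OF int_lattice_minus[OF vfloor_in_lattice]] by (metis diff_conv_add_uminus)+
  have conthp: "continuous_on UNIV (\<lambda>x. h (torus_proj x))"
    by (rule continuous_on_compose2[OF conth continuous_on_torus_proj]) simp
  have lim: "(\<lambda>n. h (torus_proj (s n))) \<longlonglongrightarrow> h (torus_proj u)" if "s \<longlonglongrightarrow> u" for s
    by (rule continuous_on_tendsto_compose[OF conthp that]) auto
  \<comment> \<open>Both subsequences tend to \<open>u\<close>, yet their values under
    \<open>h\<close> differ by the constant \<open>c\<close>. Passing to the limit forces
    \<open>c = 0\<close>.\<close>
  have "(\<lambda>n. h (torus_proj ((y \<circ> r) n)) + c) \<longlonglongrightarrow> h (torus_proj u) + c"
    by (rule continuous_on_tendsto_compose[OF torus_plus_continuous lim[OF y]]) auto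
  moreover have "h (torus_proj ((y \<circ> r) n)) + c = h (torus_proj ((x \<circ> r) n))" for n
    unfolding comp_def proj c_def using diff by metis
  ultimately have "(\<lambda>n. h (torus_proj ((x \<circ> r) n))) \<longlonglongrightarrow> h (torus_proj u) + c" by simp
  from LIMSEQ_unique[OF lim[OF u(2)] this] show False using \<open>c \<noteq> 0\<close> by simp
qed

section \<open>Rotation vectors\<close>

text \<open>Each coordinate is a continuous integer-valued function on a connected space. It follows
  that two lifts of one torus map differ by a fixed lattice vector.\<close>

lemma continuous_lattice_valued_constant:
  fixes D :: "real ^ 'n \<Rightarrow> real ^ 'n"
  assumes "continuous_on UNIV D" "\<And>x. D x \<in> int_lattice"
  shows "D x = D y"
proof -
  have "D x $ i = D y $ i" for i
  proof -
    have "(\<lambda>x. D x $ i) constant_on UNIV"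
    proof (rule continuous_discrete_range_constant[OF connected_UNIV])
      show "continuous_on UNIV (\<lambda>x. D x $ i)" by (intro continuous_intros assms)
      fix x
      show "\<exists>e>0. \<forall>y. y \<in> UNIV \<and> D y $ i \<noteq> D x $ i \<longrightarrow> e \<le> norm (D y $ i - D x $ i)"
      proof (intro exI[of _ 1] conjI allI impI)
        fix y assume "y \<in> UNIV \<and> D y $ i \<noteq> D x $ i"
        moreover have "D y $ i - D x $ i \<in> \<int>" using assms(2) by (simp add: int_lattice_def)
        ultimately show "1 \<le> norm (D y $ i - D x $ i)" using Ints_nonzero_abs_ge1[of "D y $ i - D x $ i"] by auto
      qed simp
    qed
    then show ?thesis by (auto simp: constant_on_def)
  qed
  then show ?thesis by (simp add: vec_eq_iff)
qed

text \<open>Under \<open>h\<close> an orbit advances by exactly \<open>w\<close> per step, and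
  \<open>h\<close> displaces points by at most \<open>B\<close>. So n steps of \<open>F\<close>
  displace by \<open>n w\<close> up to an error \<open>2 * B\<close>, and another lift
  \<open>F + m\<close> has the vector \<open>w + m\<close>.\<close>

lemma has_rotation_vector_torus_map:
  fixes F h :: "real ^ 'n \<Rightarrow> real ^ 'n"
  assumes eq: "equivariant F" and cont: "continuous_on UNIV F"
    and semi: "\<And>x. h (F x) = h x + w" and bd: "\<And>x. norm (h x - x) \<le> B"
  shows "has_rotation_vector (torus_map F) (torus_proj w)"
  unfolding has_rotation_vector_def
proof (intro conjI allI impI)
  show "\<exists>F'. is_lift (torus_map F) F'" using is_lift_torus_map[OF eq cont] by blast
  fix F' assume F': "is_lift (torus_map F) F'"
  define m where "m = F' 0 - F 0"
  have "F' x - F x \<in> int_lattice" for x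
    using F' by (simp add: is_lift_def torus_map_proj[OF eq] torus_proj_eq_iff)
  moreover have "continuous_on UNIV (\<lambda>x. F' x - F x)"
    using F' cont by (auto simp: is_lift_def intro: continuous_on_diff)
  ultimately have m: "m \<in> int_lattice" "F' x - F x = m" for x
    using continuous_lattice_valued_constant[of "\<lambda>x. F' x - F x" x 0] by (simp_all add: m_def)
  have F'_eq: "F' x = F x + m" for x using m(2)[of x] by (simp add: algebra_simps)
  have iter: "(F' ^^ n) z = (F ^^ n) z + real n *\<^sub>R m" for n z
    by (induction n) (simp_all add: F'_eq equivariantD[OF eq int_lattice_scaleR[OF m(1)]] algebra_simps)
  have hiter: "h ((F ^^ n) z) = h z + real n *\<^sub>R w" for n z
    by (induction n) (simp_all add: semi algebra_simps)
  show "\<exists>w'. torus_proj w' = torus_proj w \<and>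
      (\<forall>z. (\<lambda>n. ((F' ^^ n) z - z) /\<^sub>R real n) \<longlonglongrightarrow> w')"
  proof (intro exI[of _ "w + m"] conjI allI)
    show "torus_proj (w + m) = torus_proj w" by (rule torus_proj_add_lattice[OF m(1)])
    fix z
    have "(\<lambda>n. ((F' ^^ n) z - z) /\<^sub>R real n - (w + m)) \<longlonglongrightarrow> 0"
    proof (rule Lim_null_comparison)
      \<comment> \<open>At \<open>n = 0\<close> division returns 0, so the estimate is stated
        eventually.\<close>
      show "\<forall>\<^sub>F n in sequentially. norm (((F' ^^ n) z - z) /\<^sub>R real n - (w + m)) \<le> 2 * B * (1 / real n)"
        using eventually_gt_at_top[of 0]
      proof eventually_elim
        case (elim n)
        let ?d = "(F' ^^ n) z - z - real n *\<^sub>R (w + m)"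
        have d: "?d = (h z - z) - (h ((F ^^ n) z) - (F ^^ n) z)"
          by (simp add: iter hiter algebra_simps)
        have "norm ?d \<le> norm (h z - z) + norm (h ((F ^^ n) z) - (F ^^ n) z)"
          unfolding d by (rule norm_triangle_ineq4)
        also have "\<dots> \<le> 2 * B" using bd[of z] bd[of "(F ^^ n) z"] by simp
        finally have "norm ?d \<le> 2 * B" .
        moreover have "((F' ^^ n) z - z) /\<^sub>R real n - (w + m) = ?d /\<^sub>R real n"
          using elim by (simp add: scaleR_diff_right)
        ultimately show ?case using elim by (simp add: divide_inverse mult_right_mono)
      qed
      show "(\<lambda>n. 2 * B * (1 / real n)) \<longlonglongrightarrow> 0"
        by (intro tendsto_mult_right_zero lim_1_over_n)
    qed
    then show "(\<lambda>n. ((F' ^^ n) z - z) /\<^sub>R real n) \<longlonglongrightarrow> w + m" by (simp add: LIM_zero_iff)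
  qed
qed

section \<open>Homotopy to the identity and semi-conjugacy\<close>

text \<open>The product of an open quotient map with the identity is again a quotient map.\<close>

lemma continuous_on_torus_prod:
  fixes \<Phi> :: "'a::topological_space \<times> 'n::finite torus \<Rightarrow> 'b::topological_space"
  assumes "continuous_on UNIV (\<lambda>(t, x). \<Phi> (t, torus_proj x))"
  shows "continuous_on UNIV \<Phi>"
proof -
  have "open (\<Phi> -` U)" if U: "open U" for U
  proof (rule open_prod_intro)
    fix p assume p: "p \<in> \<Phi> -` U"
    obtain t z where "p = (t, z)" by force
    moreover obtain x where "z = torus_proj x" by (rule torus_cases)
    ultimately have px: "p = (t, torus_proj x)" by simp
    have "open ((\<lambda>(t, x). \<Phi> (t, torus_proj x)) -` U)" by (rule open_vimage[OF U assms])
    moreover have "(t, x) \<in> (\<lambda>(t, x). \<Phi> (t, torus_proj x)) -` U" using p px by simp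
    ultimately obtain A B where AB: "open A" "open B" "(t, x) \<in> A \<times> B"
      "A \<times> B \<subseteq> (\<lambda>(t, x). \<Phi> (t, torus_proj x)) -` U"
      by (rule open_prod_elim)
    then have "open (torus_proj ` B)" "p \<in> A \<times> torus_proj ` B" "A \<times> torus_proj ` B \<subseteq> \<Phi> -` U"
      by (auto simp: px open_image_torus_proj)
    then show "\<exists>A B. open A \<and> open B \<and> p \<in> A \<times> B \<and> A \<times> B \<subseteq> \<Phi> -` U"
      using AB(1) by blast
  qed
  then show ?thesis by (simp add: continuous_on_open_vimage)
qed

lemma semiconj_torus_map:
  fixes F h :: "real ^ 'n \<Rightarrow> real ^ 'n"
  assumes eq: "equivariant F" "equivariant h" and cont: "continuous_on UNIV h"
    and semi: "\<And>x. h (F x) = h x + w" and surj: "surj h"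
  shows "semiconj_to_translation_htpy_id (torus_map F)"
  unfolding semiconj_to_translation_htpy_id_def
proof (intro exI conjI)
  show "continuous_on UNIV (torus_map h)" by (rule continuous_torus_map[OF eq(2) cont])
  show "surj (torus_map h)"
  proof (rule surjI)
    fix z :: "'n torus"
    show "torus_map h (torus_proj (inv h (rep_torus z))) = z"
      by (simp add: torus_map_proj[OF eq(2)] surj_f_inv_f[OF surj] torus_proj_rep)
  qed
  show "torus_map h \<circ> torus_map F = torus_translation (torus_proj w) \<circ> torus_map h"
  proof
    fix z :: "'n torus"
    obtain x where "z = torus_proj x" by (rule torus_cases)
    then show "(torus_map h \<circ> torus_map F) z = (torus_translation (torus_proj w) \<circ> torus_map h) z"
      by (simp add: torus_map_proj eq semi torus_translation_def torus_proj_add)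
  qed
  \<comment> \<open>The straight-line homotopy from \<open>h\<close> to the identity is equivariant
    at every time, so it descends to the torus.\<close>
  define \<Phi> where "\<Phi> = (\<lambda>p. torus_map (\<lambda>x. (1 - fst p) *\<^sub>R h x + fst p *\<^sub>R x) (snd p))"
  have "equivariant (\<lambda>x. (1 - t) *\<^sub>R h x + t *\<^sub>R x)" for t
    using eq(2) by (simp add: equivariant_def algebra_simps)
  then have \<Phi>: "\<Phi> (t, torus_proj x) = torus_proj ((1 - t) *\<^sub>R h x + t *\<^sub>R x)" for t x
    by (simp add: \<Phi>_def torus_map_proj)
  have "continuous_on UNIV (\<lambda>p. (1 - fst p) *\<^sub>R h (snd p) + fst p *\<^sub>R snd p)"
    by (intro continuous_intros continuous_on_compose2[OF cont]) auto
  then have "continuous_on UNIV (\<lambda>(t, x). \<Phi> (t, torus_proj x))"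
    unfolding \<Phi> case_prod_beta by (rule continuous_on_compose2[OF continuous_on_torus_proj]) simp
  then have "continuous_on ({0..1} \<times> UNIV) \<Phi>"
    using continuous_on_torus_prod continuous_on_subset by blast
  moreover have "\<Phi> (0, z) = torus_map h z" "\<Phi> (1, z) = id z" for z
    by (simp_all add: \<Phi>_def) (simp add: torus_map_def torus_proj_rep)
  moreover have prod_top: "prod_topology (top_of_set {0..1::real}) (euclidean :: 'n torus topology) =
      top_of_set ({0..1} \<times> UNIV)"
    using prod_topology_subtopology_eu[of "{0..1::real}" "UNIV :: 'n torus set"] by (simp only: subtopology_UNIV)
  ultimately show "homotopic_with_canon (\<lambda>_. True) UNIV UNIV (torus_map h) id"
    unfolding homotopic_with_def
    by (intro exI[of _ \<Phi>]) (simp add: prod_top)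
qed

text \<open>At time \<open>q n\<close> the multiple of \<open>w\<close> is as close to the lattice
  point \<open>q n * v n\<close> as \<open>close\<close> says, so the normalised logarithm is at
  most \<open>- n\<close>. The condition \<open>n < q n\<close> makes these times unbounded, so they
  are seen by the liminf.\<close>

lemma super_liouvilleanI:
  fixes w :: "real ^ 'n" and q :: "nat \<Rightarrow> nat"
  assumes q: "\<And>n. n < q n" and v: "\<And>n. real (q n) *\<^sub>R v n \<in> int_lattice"
    and close: "\<And>n. real (q n) * norm (w - v n) \<le> exp (- (real n * real (q n)))"
  shows "super_liouvillean w"
proof -
  let ?a = "\<lambda>n. ereal (1 / real n) * ext_ln (torus_norm (real n *\<^sub>R w))"
  have a: "?a (q n) \<le> ereal (- real n)" for n
  proof -
    have q0: "real (q n) > 0" using q[of n] by simp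
    let ?t = "torus_norm (real (q n) *\<^sub>R w)"
    have "?t \<le> norm (real (q n) *\<^sub>R w - real (q n) *\<^sub>R v n)"
      unfolding torus_norm_def by (rule cINF_lower[OF _ v]) (auto intro: bdd_belowI[of _ 0])
    also have "\<dots> = real (q n) * norm (w - v n)" by (simp flip: scaleR_diff_right)
    finally have t: "?t \<le> exp (- (real n * real (q n)))" using close[of n] by simp
    show ?thesis
    \<comment> \<open>If the distance vanishes, \<open>ext_ln\<close> is minus infinity and the
      bound is immediate.\<close>
    proof (cases "?t \<le> 0")
      case True
      then show ?thesis using q0 by (simp add: ext_ln_def)
    next
      case False
      then have "ln ?t \<le> ln (exp (- (real n * real (q n))))"
        using t by (subst ln_le_cancel_iff) simp_all
      then have "ln ?t \<le> - (real n * real (q n))" by simp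
      then have "1 / real (q n) * ln ?t \<le> - real n"
        using q0 by (simp add: field_simps)
      then show ?thesis using False by (simp add: ext_ln_def)
    qed
  qed
  have "(INF m\<in>{n..}. ?a m) \<le> ereal B" for n B
  proof -
    obtain k where k: "real k \<ge> max (real n) (- B)" using real_arch_simple by blast
    then have "n \<le> q k" using q[of k] by simp
    then have "(INF m\<in>{n..}. ?a m) \<le> ?a (q k)" by (intro INF_lower) simp
    also have "\<dots> \<le> ereal (- real k)" by (rule a)
    also have "\<dots> \<le> ereal B" using k by simp
    finally show ?thesis .
  qed
  then have "(INF m\<in>{n..}. ?a m) = -\<infinity>" for n by (rule ereal_bot)
  then show ?thesis by (simp add: super_liouvillean_def liminf_SUP_INF)
qed

section \<open>Rational translations and robustness\<close>

text \<open>Digit \<open>s\<close> of \<open>j\<close> in base \<open>Q\<close> is the integer part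
  of \<open>Q * frac (z s)\<close>. In \<open>j / Q ^ Suc s\<close> the higher digits contribute
  integers, the lower ones at most \<open>1 / Q\<close>, and rounding the digit costs another
  \<open>1 / Q\<close>.\<close>

lemma base_digits:
  fixes z :: "nat \<Rightarrow> real"
  assumes Q: "Q > 0"
  shows "\<exists>j<Q ^ d. \<forall>s<d. \<exists>n. \<bar>real j / real Q ^ Suc s - z s - of_int n\<bar> \<le> 2 / real Q"
proof (induction d)
  case (Suc d)
  then obtain j where j: "j < Q ^ d"
    "\<And>s. s < d \<Longrightarrow> \<exists>n. \<bar>real j / real Q ^ Suc s - z s - of_int n\<bar> \<le> 2 / real Q" by blast
  define y where "y = real Q * frac (z d)"
  define a where "a = nat \<lfloor>y\<rfloor>"
  have y: "0 \<le> y" "y < real Q" using Q by (simp_all add: y_def frac_lt_1)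
  have a: "real a \<le> y" "y < real a + 1" "a < Q"
    using y unfolding a_def by (linarith, linarith, simp add: floor_less_iff nat_less_iff)
  have "j + a * Q ^ d < Suc a * Q ^ d" using j(1) by simp
  also have "\<dots> \<le> Q * Q ^ d" using a(3) by (intro mult_right_mono) auto
  finally have "j + a * Q ^ d < Q ^ Suc d" by simp
  moreover have "\<exists>n. \<bar>real (j + a * Q ^ d) / real Q ^ Suc s - z s - of_int n\<bar> \<le> 2 / real Q" if s: "s < Suc d" for s
  proof (cases "s < d")
    case True
    then obtain n where n: "\<bar>real j / real Q ^ Suc s - z s - of_int n\<bar> \<le> 2 / real Q" using j(2) by blast
    have "real Q ^ d = real Q ^ (d - Suc s) * real Q ^ Suc s"
      by (subst power_add[symmetric]) (use True in simp)
    then have "real (j + a * Q ^ d) / real Q ^ Suc s = real j / real Q ^ Suc s + real (a * Q ^ (d - Suc s))"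
      using Q by (simp add: add_divide_distrib)
    then show ?thesis
      using n by (intro exI[of _ "n + int (a * Q ^ (d - Suc s))"]) (simp add: algebra_simps)
  next
    case False
    then have s: "s = d" using s by simp
    have "real (j + a * Q ^ d) / real Q ^ Suc d = real j / real Q ^ Suc d + real a / real Q"
      using Q by (simp add: add_divide_distrib)
    moreover have "0 \<le> real j / real Q ^ Suc d" by simp
    moreover have "real j / real Q ^ Suc d \<le> 1 / real Q"
    proof -
      have "real j \<le> real Q ^ d" using j(1) by (metis less_imp_le of_nat_le_iff of_nat_power)
      then show ?thesis using Q by (simp add: field_simps)
    qed
    moreover have "real a / real Q \<le> frac (z d)" "frac (z d) \<le> real a / real Q + 1 / real Q"
      using a(1,2) Q by (simp_all add: y_def field_simps)
    moreover have "2 / real Q = 1 / real Q + 1 / real Q" by simp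
    ultimately have "\<bar>real (j + a * Q ^ d) / real Q ^ Suc d - z d - of_int (- \<lfloor>z d\<rfloor>)\<bar> \<le> 2 / real Q"
      unfolding frac_def of_int_minus by linarith
    then show ?thesis unfolding s by blast
  qed
  ultimately show ?case by blast
qed simp

text \<open>
  Perturbing \<open>w\<close> by \<open>1 / (q Q), 1 / (q Q\<^sup>2), \<dots>\<close>: along multiples \<open>q j\<close> the coordinates of the
  orbit read off the individual digits of \<open>j\<close> in base \<open>Q\<close>.
\<close>

lemma rational_dense_rotation:
  fixes w :: "real ^ 'n"
  assumes q: "q > 0" and w: "real q *\<^sub>R w \<in> int_lattice" and \<delta>: "\<delta> > 0"
  obtains w' q' N where "L < (q' :: nat)" "real q' *\<^sub>R w' \<in> int_lattice" "norm (w' - w) < \<delta>"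
    "\<And>z. \<exists>k\<le>N. \<exists>m\<in>int_lattice. norm (real k *\<^sub>R w' - z - m) < \<delta>"
proof -
  let ?d = "CARD('n)"
  obtain r where r: "bij_betw r (UNIV :: 'n set) {0..<?d}"
    using ex_bij_betw_finite_nat[OF finite] by blast
  have r_lt: "r i < ?d" for i using r by (auto simp: bij_betw_def)
  have r_inv: "inv r (r i) = i" for i using r by (simp add: bij_betw_def inv_f_f)
  have d: "?d > 0" by simp
  \<comment> \<open>\<open>Q > L\<close> makes the new denominator large, and the second bound makes
    coordinate errors of \<open>2 / Q\<close> add up to less than \<open>\<delta>\<close>.\<close>
  obtain Q :: nat where "real Q > max (real L + 1) (2 * real ?d / \<delta>)" using reals_Archimedean2 by blast
  then have Q: "L < Q" "2 * real ?d / \<delta> < real Q" "Q > 0" by linarith+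
  have small: "real ?d * (2 / real Q) < \<delta>" using Q \<delta> by (simp add: field_simps)
  have norm_small: "norm x < \<delta>" if "\<And>i. \<bar>x $ i\<bar> \<le> 2 / real Q" for x :: "real ^ 'n"
  proof -
    have "norm x \<le> (\<Sum>i\<in>UNIV. \<bar>x $ i\<bar>)" by (rule norm_le_l1_cart)
    also have "\<dots> \<le> (\<Sum>i\<in>(UNIV :: 'n set). 2 / real Q)" by (intro sum_mono that)
    finally show ?thesis using small by simp
  qed
  define w' where "w' = (\<chi> i. w $ i + 1 / (real q * real Q ^ Suc (r i)))"
  have qw: "real q * w $ i \<in> \<int>" for i using w by (simp add: int_lattice_def)
  show thesis
  \<comment> \<open>This number clears all denominators of \<open>w'\<close>. It also bounds the
    times \<open>q * j\<close> that are used, as \<open>j < Q ^ ?d\<close>.\<close>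
  proof (rule that[of "q * Q ^ ?d" w' "q * Q ^ ?d"])
    have "Q ^ 1 \<le> Q ^ ?d" using d Q(3) by (intro power_increasing) (auto simp: Suc_leI)
    then have "Q \<le> q * Q ^ ?d" using mult_le_mono[of 1 q Q "Q ^ ?d"] q by simp
    then show "L < q * Q ^ ?d" using Q(1) by simp
    have "real (q * Q ^ ?d) * w' $ i \<in> \<int>" for i
    proof -
      have "real Q ^ ?d = real Q ^ (?d - Suc (r i)) * real Q ^ Suc (r i)"
        by (subst power_add[symmetric]) (use r_lt[of i] in simp)
      then have "real (q * Q ^ ?d) * w' $ i = real (Q ^ ?d) * (real q * w $ i) + real (Q ^ (?d - Suc (r i)))"
        using q Q(3) by (simp add: w'_def field_simps)
      then show ?thesis using qw by simp
    qed
    then show "real (q * Q ^ ?d) *\<^sub>R w' \<in> int_lattice" by (simp add: int_lattice_def)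
    show "norm (w' - w) < \<delta>"
    proof (rule norm_small)
      fix i
      have "1 \<le> real q * real Q ^ r i"
        using of_nat_mono[of 1 "q * Q ^ r i", where 'a = real] q Q(3) by (simp add: Suc_le_eq)
      then have "1 / (real q * real Q ^ r i * real Q) \<le> 1 / real Q"
        using q Q(3) by (intro divide_left_mono mult_pos_pos) auto
      moreover have "(w' - w) $ i = 1 / (real q * real Q ^ r i * real Q)"
        by (simp add: w'_def mult_ac)
      moreover have "0 \<le> 1 / (real q * real Q ^ r i * real Q)" by simp
      moreover have "1 / real Q \<le> 2 / real Q" by (simp add: divide_right_mono)
      ultimately show "\<bar>(w' - w) $ i\<bar> \<le> 2 / real Q" by (metis abs_of_nonneg order_trans)
    qed
    fix z :: "real ^ 'n"
    obtain j where j: "j < Q ^ ?d"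
      "\<And>s. s < ?d \<Longrightarrow> \<exists>n. \<bar>real j / real Q ^ Suc s - z $ (inv r s) - of_int n\<bar> \<le> 2 / real Q"
      using base_digits[OF Q(3), of ?d "\<lambda>s. z $ (inv r s)"] by blast
    have "\<exists>n. \<bar>real j / real Q ^ Suc (r i) - z $ i - of_int n\<bar> \<le> 2 / real Q" for i
      using j(2)[OF r_lt[of i]] by (simp add: r_inv)
    then obtain n where n: "\<And>i. \<bar>real j / real Q ^ Suc (r i) - z $ i - of_int (n i)\<bar> \<le> 2 / real Q" by metis
    \<comment> \<open>At time \<open>q * j\<close> the contribution of \<open>w\<close> is the
      integer vector \<open>j * q * w\<close>, which \<open>m\<close> removes together with the
      integer error of the digits.\<close>
    define m where "m = (\<chi> i. real j * (real q * w $ i) + of_int (n i))"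
    have "m \<in> int_lattice" using qw by (simp add: m_def int_lattice_def)
    moreover have "norm (real (q * j) *\<^sub>R w' - z - m) < \<delta>"
    proof (rule norm_small)
      fix i
      have "(real (q * j) *\<^sub>R w' - z - m) $ i = real j / real Q ^ Suc (r i) - z $ i - of_int (n i)"
        using q by (simp add: w'_def m_def algebra_simps)
      then show "\<bar>(real (q * j) *\<^sub>R w' - z - m) $ i\<bar> \<le> 2 / real Q" using n[of i] by presburger
    qed
    moreover have "q * j \<le> q * Q ^ ?d" using j(1) by simp
    ultimately show "\<exists>k\<le>q * Q ^ ?d. \<exists>m\<in>int_lattice. norm (real k *\<^sub>R w' - z - m) < \<delta>" by blast
  qed
qed

section \<open>Robustness under uniform perturbations\<close>

text \<open>Induction on the number of iterates: one more application adds the perturbation and the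
  distortion by \<open>F\<close>, each at most \<open>\<epsilon> / 2\<close>. The earlier iterates
  must be within \<open>\<delta>\<close> for the distortion and within \<open>\<epsilon>\<close> for
  the claim itself.\<close>

lemma funpow_close:
  fixes F :: "real ^ 'n \<Rightarrow> real ^ 'n"
  assumes F: "equivariant F" "continuous_on UNIV F" and "\<epsilon> > 0"
  shows "\<exists>\<eta>>0. \<forall>G. (\<forall>x. norm (G x - F x) \<le> \<eta>) \<longrightarrow> (\<forall>k\<le>N. \<forall>x. norm ((G ^^ k) x - (F ^^ k) x) < \<epsilon>)"
  using \<open>\<epsilon> > 0\<close>
proof (induction N arbitrary: \<epsilon>)
  case 0
  then show ?case by (intro exI[of _ 1]) simp
next
  case (Suc N)
  obtain \<delta> where \<delta>: "\<delta> > 0" "\<And>x y. norm (x - y) < \<delta> \<Longrightarrow> norm (F x - F y) < \<epsilon> / 2"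
    using equivariant_uniformly_continuous[OF F, of "\<epsilon> / 2"] Suc.prems by auto
  obtain \<eta> where \<eta>: "\<eta> > 0" "\<And>G k x. (\<And>x. norm (G x - F x) \<le> \<eta>) \<Longrightarrow> k \<le> N \<Longrightarrow> norm ((G ^^ k) x - (F ^^ k) x) < min \<delta> \<epsilon>"
    using Suc.IH[of "min \<delta> \<epsilon>"] \<delta>(1) Suc.prems by auto
  show ?case
  proof (intro exI[of _ "min \<eta> (\<epsilon> / 2)"] conjI allI impI)
    show "0 < min \<eta> (\<epsilon> / 2)" using \<eta>(1) Suc.prems by simp
    fix G k x assume G: "\<forall>x. norm (G x - F x) \<le> min \<eta> (\<epsilon> / 2)" and k: "k \<le> Suc N"
    show "norm ((G ^^ k) x - (F ^^ k) x) < \<epsilon>"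
    proof (cases k)
      case (Suc l)
      have l: "norm ((G ^^ l) x - (F ^^ l) x) < min \<delta> \<epsilon>"
        using \<eta>(2)[of G l x] G k Suc by simp
      have "norm ((G ^^ k) x - (F ^^ k) x) \<le>
          norm (G ((G ^^ l) x) - F ((G ^^ l) x)) + norm (F ((G ^^ l) x) - F ((F ^^ l) x))"
        using norm_triangle_ineq[of "G ((G ^^ l) x) - F ((G ^^ l) x)" "F ((G ^^ l) x) - F ((F ^^ l) x)"]
        by (simp add: Suc)
      also have "\<dots> < \<epsilon> / 2 + \<epsilon> / 2"
        using G \<delta>(2)[of "(G ^^ l) x" "(F ^^ l) x"] l by (intro add_le_less_mono) auto
      finally show ?thesis by simp
    qed (use Suc.prems in simp)
  qed
qed

text \<open>Only iterates up to \<open>N\<close> enter, and \<open>funpow_close\<close> keeps them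
  within \<open>\<epsilon>\<close>; the triangle inequality gives the factor 2.\<close>

lemma orbit_dense_robust:
  fixes F :: "real ^ 'n \<Rightarrow> real ^ 'n"
  assumes F: "equivariant F" "continuous_on UNIV F" and "\<epsilon> > 0" "orbit_dense \<epsilon> F"
  shows "\<exists>\<eta>>0. \<forall>G. (\<forall>x. norm (G x - F x) \<le> \<eta>) \<longrightarrow> orbit_dense (2 * \<epsilon>) G"
proof -
  obtain N where N: "\<And>x y. \<exists>k\<le>N. \<exists>m\<in>int_lattice. norm ((F ^^ k) x - y - m) < \<epsilon>"
    using assms(4) unfolding orbit_dense_def by blast
  obtain \<eta> where \<eta>: "\<eta> > 0"
    "\<And>G k x. (\<forall>x. norm (G x - F x) \<le> \<eta>) \<Longrightarrow> k \<le> N \<Longrightarrow> norm ((G ^^ k) x - (F ^^ k) x) < \<epsilon>"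
    using funpow_close[OF F \<open>\<epsilon> > 0\<close>, of N] by blast
  have "orbit_dense (2 * \<epsilon>) G" if G: "\<forall>x. norm (G x - F x) \<le> \<eta>" for G
    unfolding orbit_dense_def
  proof (rule exI[of _ N], intro allI)
    fix x y
    obtain k m where km: "k \<le> N" "m \<in> int_lattice" "norm ((F ^^ k) x - y - m) < \<epsilon>" using N by blast
    have "norm ((G ^^ k) x - y - m) < 2 * \<epsilon>"
      using norm_triangle_ineq[of "(G ^^ k) x - (F ^^ k) x" "(F ^^ k) x - y - m"] \<eta>(2)[OF G km(1), of x] km(3)
      by (simp add: algebra_simps)
    then show "\<exists>k\<le>N. \<exists>m\<in>int_lattice. norm ((G ^^ k) x - y - m) < 2 * \<epsilon>" using km by blast
  qed
  then show ?thesis using \<eta>(1) by blast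
qed

text \<open>Here both end points of one iterate are perturbed, which gives the factor 3.\<close>

lemma near_collision_robust:
  fixes F :: "real ^ 'n \<Rightarrow> real ^ 'n"
  assumes F: "equivariant F" "continuous_on UNIV F" and "\<epsilon> > 0" "near_collision p q \<epsilon> F"
  shows "\<exists>\<eta>>0. \<forall>G. (\<forall>x. norm (G x - F x) \<le> \<eta>) \<longrightarrow> near_collision p q (3 * \<epsilon>) G"
proof -
  obtain N where N: "norm ((F ^^ N) p - (F ^^ N) q) < \<epsilon>"
    using assms(4) unfolding near_collision_def by blast
  obtain \<eta> where \<eta>: "\<eta> > 0"
    "\<And>G k x. (\<forall>x. norm (G x - F x) \<le> \<eta>) \<Longrightarrow> k \<le> N \<Longrightarrow> norm ((G ^^ k) x - (F ^^ k) x) < \<epsilon>"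
    using funpow_close[OF F \<open>\<epsilon> > 0\<close>, of N] by blast
  have "near_collision p q (3 * \<epsilon>) G" if G: "\<forall>x. norm (G x - F x) \<le> \<eta>" for G
    unfolding near_collision_def
  proof (intro exI[of _ N])
    have "norm ((G ^^ N) p - (G ^^ N) q) \<le> norm ((G ^^ N) p - (F ^^ N) p)
        + norm ((F ^^ N) p - (F ^^ N) q) + norm ((G ^^ N) q - (F ^^ N) q)"
      using norm_triangle_ineq[of "(G ^^ N) p - (F ^^ N) p" "(F ^^ N) p - (F ^^ N) q"]
        norm_triangle_ineq4[of "(G ^^ N) p - (F ^^ N) q" "(G ^^ N) q - (F ^^ N) q"] by simp
    then show "norm ((G ^^ N) p - (G ^^ N) q) < 3 * \<epsilon>"
      using \<eta>(2)[OF G order_refl, of p] \<eta>(2)[OF G order_refl, of q] N by simp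
  qed
  then show ?thesis using \<eta>(1) by blast
qed

section \<open>Orbits of conjugated translations\<close>

lemma conj_translation_funpow:
  assumes "\<And>x. H (K x) = x" "\<And>x. K (H x) = x"
  shows "(conj_translation H K w ^^ k) x = H (K x + real k *\<^sub>R w)"
  by (induction k) (simp_all add: assms conj_translation_def algebra_simps)

lemma orbit_dense_conj_translation:
  assumes inv: "\<And>x. H (K x) = x" "\<And>x. K (H x) = x" and eq: "equivariant H"
    and \<delta>: "\<And>x y. norm (x - y) < \<delta> \<Longrightarrow> norm (H x - H y) < \<epsilon>"
    and dense: "\<And>z. \<exists>k\<le>N. \<exists>m\<in>int_lattice. norm (real k *\<^sub>R w - z - m) < \<delta>"
  shows "orbit_dense \<epsilon> (conj_translation H K w)"
  unfolding orbit_dense_def conj_translation_funpow[OF inv]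
proof (rule exI[of _ N], intro allI)
  fix x y
  obtain k m where km: "k \<le> N" "m \<in> int_lattice" "norm (real k *\<^sub>R w - (K y - K x) - m) < \<delta>"
    using dense by blast
  have "norm ((K x + real k *\<^sub>R w) - (K y + m)) < \<delta>" using km(3) by (simp add: algebra_simps)
  from \<delta>[OF this] have "norm (H (K x + real k *\<^sub>R w) - y - m) < \<epsilon>"
    by (simp only: equivariantD[OF eq km(2)] inv diff_diff_add)
  then show "\<exists>k\<le>N. \<exists>m\<in>int_lattice. norm (H (K x + real k *\<^sub>R w) - y - m) < \<epsilon>" using km by blast
qed

text \<open>A multiple of \<open>w\<close> carries \<open>K p\<close> close to \<open>a\<close>
  modulo the lattice, and then \<open>K q\<close> close to \<open>a\<close> plus the difference
  \<open>K q - K p\<close>. \<open>H\<close> brings these two targets together by \<open>a\<close>;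
  the three errors are at most \<open>\<epsilon>\<close> each.\<close>

lemma near_collision_conj_translation:
  assumes inv: "\<And>x. H (K x) = x" "\<And>x. K (H x) = x" and eq: "equivariant H"
    and \<delta>: "\<And>x y. norm (x - y) < \<delta> \<Longrightarrow> norm (H x - H y) < \<epsilon>"
    and dense: "\<And>z. \<exists>k\<le>N. \<exists>m\<in>int_lattice. norm (real k *\<^sub>R w - z - m) < \<delta>"
    and a: "norm (H (a + (K q - K p)) - H a) < \<epsilon>"
  shows "near_collision p q (3 * \<epsilon>) (conj_translation H K w)"
proof -
  obtain k m where km: "m \<in> int_lattice" "norm (real k *\<^sub>R w - (a - K p) - m) < \<delta>"
    using dense by blast
  let ?e = "K q - K p"
  have "norm ((K p + real k *\<^sub>R w) - (a + m)) < \<delta>" "norm ((K q + real k *\<^sub>R w) - (a + ?e + m)) < \<delta>"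
    using km(2) by (simp_all add: algebra_simps)
  from this[THEN \<delta>]
  have 1: "norm (H (K p + real k *\<^sub>R w) - (H a + m)) < \<epsilon>"
    "norm (H (K q + real k *\<^sub>R w) - (H (a + ?e) + m)) < \<epsilon>"
    by (simp_all add: equivariantD[OF eq km(1)])
  let ?A = "H (K p + real k *\<^sub>R w) - (H a + m)" and ?B = "H (K q + real k *\<^sub>R w) - (H (a + ?e) + m)"
    and ?C = "H (a + ?e) - H a"
  have "H (K p + real k *\<^sub>R w) - H (K q + real k *\<^sub>R w) = ?A - ?B - ?C" by simp
  then have "norm (H (K p + real k *\<^sub>R w) - H (K q + real k *\<^sub>R w)) \<le> norm ?A + norm ?B + norm ?C"
    using norm_triangle_ineq4[of "?A - ?B" ?C] norm_triangle_ineq4[of ?A ?B] by simp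
  then have "norm (H (K p + real k *\<^sub>R w) - H (K q + real k *\<^sub>R w)) < 3 * \<epsilon>" using 1 a by linarith
  then show ?thesis
    unfolding near_collision_def conj_translation_funpow[OF inv] by blast
qed

section \<open>Periodic shears\<close>

lemma sin_pi_shift_sq:
  assumes "n \<in> \<int>"
  shows "(sin (x + pi * n))\<^sup>2 = (sin (x :: real))\<^sup>2"
proof -
  obtain k where k: "n = of_int k" using assms by (elim Ints_cases)
  have "sin (x + pi * n) = sin x * cos (pi * of_int k)"
    by (simp add: sin_add k sin_npi_int)
  moreover have "(cos (pi * of_int k :: real))\<^sup>2 = 1"
    using sin_cos_squared_add[of "pi * of_int k :: real"] by (simp add: sin_npi_int)
  ultimately show ?thesis by (simp add: power_mult_distrib)
qed

lemma sin_sq_diff: "\<bar>(sin x)\<^sup>2 - (sin y)\<^sup>2\<bar> \<le> \<bar>x - y :: real\<bar>"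
proof -
  have "(sin x)\<^sup>2 - (sin y)\<^sup>2 = sin (x + y) * sin (x - y)"
  proof -
    have "sin (x + y) * sin (x - y) = (sin x)\<^sup>2 * (cos y)\<^sup>2 - (cos x)\<^sup>2 * (sin y)\<^sup>2"
      by (simp add: sin_add sin_diff power2_eq_square algebra_simps)
    then show ?thesis by (simp add: cos_squared_eq algebra_simps)
  qed
  moreover have "\<bar>sin (x + y)\<bar> * \<bar>sin (x - y)\<bar> \<le> 1 * \<bar>x - y\<bar>"
    by (intro mult_mono abs_sin_x_le_abs_x) auto
  ultimately show ?thesis by (simp add: abs_mult)
qed

text \<open>By the doubling formula, \<open>sin\<^sup>2\<close> at least doubles with its argument as long as it is below \<open>1/2\<close>.\<close>

lemma ex_multiplier_sin_sq:
  fixes x :: real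
  assumes "x \<notin> \<int>"
  obtains M :: nat where "M > 0" "(sin (pi * (real M * x)))\<^sup>2 \<ge> 1 / 2"
proof -
  define s where "s k = (sin (pi * (2 ^ k * x)))\<^sup>2" for k :: nat
  have s0: "s 0 > 0"
  proof -
    have "sin (pi * x) \<noteq> 0" using assms sin_zero_iff_int2[of "pi * x"] by (auto simp: Ints_def)
    then show ?thesis by (simp add: s_def)
  qed
  have dbl: "s (Suc k) = 4 * s k * (1 - s k)" for k
  proof -
    have "sin (pi * (2 ^ Suc k * x)) = 2 * sin (pi * (2 ^ k * x)) * cos (pi * (2 ^ k * x))"
      using sin_double[of "pi * (2 ^ k * x)"] by (simp add: mult_ac)
    then show ?thesis by (simp add: s_def power_mult_distrib cos_squared_eq)
  qed
  have "\<exists>k. s k \<ge> 1 / 2"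
  proof (rule ccontr)
    assume "\<not> (\<exists>k. s k \<ge> 1 / 2)"
    then have lt: "s k < 1 / 2" for k by (simp add: not_le)
    have "s k \<ge> 2 ^ k * s 0" for k
    proof (induction k)
      case (Suc k)
      have "0 \<le> s k" by (simp add: s_def)
      then have "4 * s k * (1 - s k) \<ge> 4 * s k * (1 / 2)" using lt[of k] by (intro mult_left_mono) auto
      then show ?case using Suc unfolding dbl power_Suc by linarith
    qed simp
    moreover obtain k :: nat where "1 / s 0 < 2 ^ k" using real_arch_pow[of 2 "1 / s 0"] by auto
    then have "1 < 2 ^ k * s 0" using s0 by (simp add: field_simps)
    ultimately have "1 < s k" by (smt (verit))
    then show False using lt[of k] by simp
  qed
  then obtain k where "s k \<ge> 1 / 2" by blast
  then show thesis using that[of "2 ^ k"] by (simp add: s_def)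
qed

text \<open>Three features matter: period \<open>1 / \<nu>\<close>, so that shears commute with
  rational translations; a zero at \<open>s\<close>, so that a base point stays fixed; and evenness
  about \<open>s\<close>, so that two points symmetric about it move equally.\<close>

definition bump :: "real \<Rightarrow> nat \<Rightarrow> real \<Rightarrow> real \<Rightarrow> real" where
  "bump c \<nu> s t = c * (sin (pi * (real \<nu> * (t - s))))\<^sup>2"

lemma bump_shift: "real \<nu> * u \<in> \<int> \<Longrightarrow> bump c \<nu> s (t + u) = bump c \<nu> s t"
  using sin_pi_shift_sq[of "real \<nu> * u" "pi * (real \<nu> * (t - s))"]
  by (simp add: bump_def algebra_simps)

lemma bump_self [simp]: "bump c \<nu> s s = 0"
  by (simp add: bump_def)

lemma bump_symmetric: "bump c \<nu> s (s - t) = bump c \<nu> s (s + t)"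
  by (simp add: bump_def)

lemma bump_bound: "\<bar>bump c \<nu> s t\<bar> \<le> \<bar>c\<bar>"
proof -
  have "(sin (pi * (real \<nu> * (t - s))))\<^sup>2 \<le> 1" by (simp add: power_le_one abs_square_le_1)
  then show ?thesis by (simp add: bump_def abs_mult mult_left_le)
qed

lemma bump_lipschitz: "\<bar>bump c \<nu> s t - bump c \<nu> s t'\<bar> \<le> \<bar>c\<bar> * (pi * real \<nu>) * \<bar>t - t'\<bar>"
proof -
  have "\<bar>bump c \<nu> s t - bump c \<nu> s t'\<bar>
      = \<bar>c\<bar> * \<bar>(sin (pi * (real \<nu> * (t - s))))\<^sup>2 - (sin (pi * (real \<nu> * (t' - s))))\<^sup>2\<bar>"
    by (simp add: bump_def flip: right_diff_distrib abs_mult)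
  also have "\<dots> \<le> \<bar>c\<bar> * \<bar>pi * (real \<nu> * (t - s)) - pi * (real \<nu> * (t' - s))\<bar>"
    by (intro mult_left_mono sin_sq_diff) simp
  also have "pi * (real \<nu> * (t - s)) - pi * (real \<nu> * (t' - s)) = (pi * real \<nu>) * (t - t')"
    by (simp add: algebra_simps)
  finally show ?thesis by (simp add: abs_mult mult.assoc)
qed

lemma smooth_bump: "smooth (bump c \<nu> s)"
proof -
  have "bump c \<nu> s = (\<lambda>t. c *\<^sub>R (sin ((pi * real \<nu>) *\<^sub>R t + - (pi * real \<nu> * s)) *\<^sub>R
      sin ((pi * real \<nu>) *\<^sub>R t + - (pi * real \<nu> * s))))"
    by (simp add: fun_eq_iff bump_def power2_eq_square algebra_simps)
  moreover have "smooth (\<lambda>t. sin ((pi * real \<nu>) *\<^sub>R t + - (pi * real \<nu> * s)))"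
    by (rule smooth_compose[OF smooth_sin], rule smooth_add[OF _ smooth_const],
        rule smooth_linear[OF bounded_linear_scaleR_right smooth_id])
  ultimately show ?thesis
    using smooth_linear[OF bounded_linear_scaleR_right smooth_scaleR] by metis
qed

section \<open>Diffeomorphisms commuting with rational translations\<close>

text \<open>The vectors \<open>u\<close> include the lattice and every \<open>w\<close> with
  denominator \<open>q\<close>. For \<open>q = 1\<close> the condition is equivariance.\<close>

definition lattice_diffeo :: "nat \<Rightarrow> (real ^ 'n \<Rightarrow> real ^ 'n) \<Rightarrow> (real ^ 'n \<Rightarrow> real ^ 'n) \<Rightarrow> bool" where
  "lattice_diffeo q F G \<longleftrightarrow>
    smooth F \<and> smooth G \<and> volume_preserving F \<and> volume_preserving G \<and>
    (\<forall>x. F (G x) = x) \<and> (\<forall>x. G (F x) = x) \<and>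
    (\<forall>u x. real q *\<^sub>R u \<in> int_lattice \<longrightarrow> F (x + u) = F x + u) \<and>
    (\<forall>u x. real q *\<^sub>R u \<in> int_lattice \<longrightarrow> G (x + u) = G x + u)"

lemma lattice_diffeoD:
  assumes "lattice_diffeo q F G"
  shows "smooth F" "smooth G" "volume_preserving F" "volume_preserving G"
    "F (G x) = x" "G (F x) = x" "equivariant F" "equivariant G"
    "real q *\<^sub>R u \<in> int_lattice \<Longrightarrow> F (x + u) = F x + u"
    "real q *\<^sub>R u \<in> int_lattice \<Longrightarrow> G (x + u) = G x + u"
  using assms by (auto simp: lattice_diffeo_def equivariant_def int_lattice_scaleR)

lemma lattice_diffeo_one: "lattice_diffeo q F G \<Longrightarrow> lattice_diffeo 1 F G"
  using lattice_diffeoD(7,8)[of q F G] by (simp add: lattice_diffeo_def equivariant_def)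

lemma lattice_diffeo_compose:
  assumes "lattice_diffeo q F G" "lattice_diffeo q F' G'"
  shows "lattice_diffeo q (\<lambda>x. F (F' x)) (\<lambda>x. G' (G x))"
  using assms smooth_compose[of F F'] smooth_compose[of G' G]
    volume_preserving_compose[of F F'] volume_preserving_compose[of G' G]
  unfolding lattice_diffeo_def by simp

lemma lattice_diffeo_id: "lattice_diffeo q (\<lambda>x. x) (\<lambda>x. x)"
  by (simp add: lattice_diffeo_def smooth_id volume_preserving_id)

text \<open>If \<open>q u\<close> is a lattice vector, each coordinate of \<open>u\<close> is a
  multiple of \<open>1 / q\<close>, which is a period of the profile because \<open>q\<close>
  divides \<open>\<nu>\<close>.\<close>

lemma lattice_diffeo_shear:
  fixes i j :: "'n::finite"
  assumes "i \<noteq> j" "q dvd \<nu>"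
  shows "lattice_diffeo q (shear i j (\<lambda>t. - bump c \<nu> s t)) (shear i j (bump c \<nu> s))"
proof -
  have neg: "(\<lambda>t. - bump c \<nu> s t) = bump (- c) \<nu> s" by (simp add: fun_eq_iff bump_def)
  have sm: "smooth (shear i j (bump c \<nu> s))" for c
  proof -
    have "shear i j (bump c \<nu> s) = (\<lambda>x. x + bump c \<nu> s (x \<bullet> axis i 1) *\<^sub>R axis j 1)"
      by (simp add: fun_eq_iff vec_eq_iff shear_component inner_axis) (simp add: axis_def)
    moreover have "smooth (\<lambda>x. x + bump c \<nu> s (x \<bullet> axis i 1) *\<^sub>R axis j 1)"
      by (intro smooth_add smooth_id smooth_scaleR smooth_const smooth_compose[OF smooth_bump]
          smooth_linear[OF bounded_linear_inner_left smooth_id])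
    ultimately show ?thesis by simp
  qed
  have meas: "bump c \<nu> s \<in> borel_measurable borel" for c
    by (rule borel_measurable_continuous_onI[OF smooth_continuous[OF smooth_bump]])
  have comm: "shear i j (bump c \<nu> s) (x + u) = shear i j (bump c \<nu> s) x + u"
    if "real q *\<^sub>R u \<in> int_lattice" for c x u
  proof -
    obtain l where l: "\<nu> = q * l" using assms(2) by blast
    have "real q * u $ i \<in> \<int>" using that by (simp add: int_lattice_def)
    then have "real l * (real q * u $ i) \<in> \<int>" by simp
    then have "real \<nu> * u $ i \<in> \<int>" by (simp add: l mult_ac)
    then show ?thesis by (simp add: shear_def bump_shift)
  qed
  show ?thesis
    unfolding lattice_diffeo_def
    using sm comm volume_preserving_shear[OF assms(1) meas]
      shear_inverse[OF assms(1), of "bump c \<nu> s"] shear_inverse[OF assms(1), of "\<lambda>t. - bump c \<nu> s t"]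
    by (simp add: neg)
qed

text \<open>Irrationality ensures that the profile of a shear with suitable frequency is nonzero at
  this difference, whatever \<open>q\<close> is; it persists when coordinates are divided by natural
  numbers. Shears in the plane of \<open>i\<close> and \<open>j\<close> keep the other coordinates
  zero.\<close>

definition irrational_pair :: "'n \<Rightarrow> 'n \<Rightarrow> real ^ 'n \<Rightarrow> bool" where
  "irrational_pair i j e \<longleftrightarrow> e $ i \<notin> \<rat> \<and> e $ j \<notin> \<rat> \<and> (\<forall>k. k \<noteq> i \<longrightarrow> k \<noteq> j \<longrightarrow> e $ k = 0)"

lemma irrational_divide_nat: "x \<notin> \<rat> \<Longrightarrow> N > 0 \<Longrightarrow> x / real N \<notin> \<rat>"
proof
  assume "x / real N \<in> \<rat>" "N > 0" "x \<notin> \<rat>"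
  then have "x / real N * real N \<in> \<rat>" by (intro Rats_mult Rats_of_nat)
  then show False using \<open>N > 0\<close> \<open>x \<notin> \<rat>\<close> by simp
qed

lemma irrational_mult_nat: "x \<notin> \<rat> \<Longrightarrow> N > 0 \<Longrightarrow> real N * x \<notin> \<int>"
proof
  assume "real N * x \<in> \<int>" "N > 0" "x \<notin> \<rat>"
  then have "real N * x / real N \<in> \<rat>" using Ints_subset_Rats by (intro Rats_divide Rats_of_nat) auto
  then show False using \<open>N > 0\<close> \<open>x \<notin> \<rat>\<close> by simp
qed

lemma ex_nat_divide_less:
  fixes A :: real
  assumes "\<delta> > 0"
  obtains N :: nat where "N \<ge> 2" "\<bar>A\<bar> / real N < \<delta>"
proof -
  obtain N :: nat where "real N > max 2 (\<bar>A\<bar> / \<delta>)" using reals_Archimedean2 by blast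
  then show thesis using that[of N] assms by (simp add: field_simps)
qed

text \<open>The frequency \<open>q * M\<close> is chosen so that the squared sine at distance
  \<open>x\<close> from the centre is at least 1/2. An amplitude of at most twice the required
  displacement then achieves it; both work for every centre \<open>s\<close>.\<close>

lemma ex_contracting_bump:
  assumes "x \<notin> \<rat>" "q > 0"
  obtains \<nu> where "q dvd \<nu>"
    "\<And>N. N \<ge> 2 \<Longrightarrow> \<exists>c. \<bar>c\<bar> \<le> 2 * \<bar>y\<bar> \<and> (\<forall>s. bump c \<nu> s (s + x) = y / real N - y)"
proof -
  obtain M where M: "M > 0" "(sin (pi * (real M * (real q * x))))\<^sup>2 \<ge> 1 / 2"
    using ex_multiplier_sin_sq[OF irrational_mult_nat[OF assms]] by blast
  let ?\<sigma> = "(sin (pi * (real M * (real q * x))))\<^sup>2"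
  show thesis
  proof (rule that[of "q * M"])
    fix N :: nat assume N: "N \<ge> 2"
    let ?c = "(y / real N - y) / ?\<sigma>"
    have "y / real N - y = - ((1 - 1 / real N) * y)" using N by (simp add: field_simps)
    then have "\<bar>y / real N - y\<bar> = (1 - 1 / real N) * \<bar>y\<bar>" using N by (simp add: abs_mult)
    also have "\<dots> \<le> 1 * \<bar>y\<bar>" by (intro mult_right_mono) auto
    finally have y: "\<bar>y / real N - y\<bar> \<le> \<bar>y\<bar>" by simp
    have "\<bar>?c\<bar> = \<bar>y / real N - y\<bar> / ?\<sigma>" by (simp add: abs_divide)
    also have "\<dots> \<le> \<bar>y\<bar> / (1 / 2)" using y M(2) by (intro frac_le) auto
    finally have "\<bar>?c\<bar> \<le> 2 * \<bar>y\<bar>" by simp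
    moreover have "bump ?c (q * M) s (s + x) = y / real N - y" for s
    proof -
      have "pi * (real (q * M) * (s + x - s)) = pi * (real M * (real q * x))" by simp
      then have "bump ?c (q * M) s (s + x) = ?c * ?\<sigma>" by (simp only: bump_def)
      moreover have "?\<sigma> \<noteq> 0" using M(2) by auto
      ultimately show ?thesis by (metis nonzero_eq_divide_eq)
    qed
    ultimately show "\<exists>c. \<bar>c\<bar> \<le> 2 * \<bar>y\<bar> \<and> (\<forall>s. bump c (q * M) s (s + x) = y / real N - y)" by blast
  qed simp
qed

lemma norm_two_components:
  fixes e :: "real ^ 'n"
  assumes "i \<noteq> j" "\<And>k. k \<noteq> i \<Longrightarrow> k \<noteq> j \<Longrightarrow> e $ k = 0"
  shows "norm e \<le> \<bar>e $ i\<bar> + \<bar>e $ j\<bar>"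
proof -
  have "norm e \<le> (\<Sum>k\<in>UNIV. \<bar>e $ k\<bar>)" by (rule norm_le_l1_cart)
  also have "\<dots> = (\<Sum>k\<in>{i, j}. \<bar>e $ k\<bar>)" by (rule sum.mono_neutral_right) (use assms in auto)
  finally show ?thesis using assms(1) by simp
qed

section \<open>The inductive step and limits\<close>

lemma abs_divide_nat_le_half: "N \<ge> 2 \<Longrightarrow> \<bar>x / real N\<bar> \<le> \<bar>x\<bar> / 2"
  using frac_le[of "\<bar>x\<bar>" "\<bar>x\<bar>" 2 "real N"] by (simp add: abs_divide)

text \<open>\<open>T\<close> fixes \<open>P\<close>; its first shear divides the
  \<open>j\<close>-part of \<open>e\<close> by \<open>N\<close>, and its second divides the
  \<open>i\<close>-part by \<open>N'\<close>. The inverse \<open>S\<close> may expand strongly in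
  general, but the pair \<open>a\<close>, \<open>a + e'\<close> is chosen so that it stays
  together.\<close>

lemma ex_contracting_diffeo:
  fixes e P :: "real ^ 'n"
  assumes ij: "i \<noteq> j" and q: "q > 0" and e: "irrational_pair i j e" and \<delta>: "\<delta> > 0"
  obtains S T a e' where "lattice_diffeo q S T" "T (P + e) - T P = e'"
    "irrational_pair i j e'" "\<bar>e' $ i\<bar> \<le> \<bar>e $ i\<bar> / 2" "\<bar>e' $ j\<bar> \<le> \<bar>e $ j\<bar> / 2"
    "\<And>x. norm (T x - x) \<le> 2 * (\<bar>e $ i\<bar> + \<bar>e $ j\<bar>)"
    "norm (S (a + e') - S a) < \<delta>"
proof -
  have irr: "e $ i \<notin> \<rat>" "e $ j \<notin> \<rat>" and e0: "\<And>k. k \<noteq> i \<Longrightarrow> k \<noteq> j \<Longrightarrow> e $ k = 0"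
    using e by (simp_all add: irrational_pair_def)
  obtain \<nu> where \<nu>: "q dvd \<nu>"
    "\<And>N. N \<ge> 2 \<Longrightarrow> \<exists>c. \<bar>c\<bar> \<le> 2 * \<bar>e $ j\<bar> \<and> (\<forall>s. bump c \<nu> s (s + e $ i) = e $ j / real N - e $ j)"
    using ex_contracting_bump[OF irr(1) q, of "e $ j"] by blast
  \<comment> \<open>\<open>L\<close> bounds the effect of \<open>S1\<close> on a difference in
    coordinate \<open>i\<close>. It is fixed before \<open>N'\<close>, so \<open>x\<close> can be
    made small compared with \<open>1 / L\<close>.\<close>
  define L where "L = 1 + 2 * \<bar>e $ j\<bar> * (pi * real \<nu>)"
  have L: "L \<ge> 1" by (simp add: L_def)
  obtain N where N: "N \<ge> 2" "\<bar>e $ j\<bar> / real N < \<delta> / 2"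
    using ex_nat_divide_less[of "\<delta> / 2" "e $ j"] \<delta> by auto
  obtain c where c: "\<bar>c\<bar> \<le> 2 * \<bar>e $ j\<bar>" "\<And>s. bump c \<nu> s (s + e $ i) = e $ j / real N - e $ j"
    using \<nu>(2)[OF N(1)] by blast
  define y where "y = e $ j / real N"
  have y: "y \<notin> \<rat>" "\<bar>y\<bar> < \<delta> / 2" "\<bar>y\<bar> \<le> \<bar>e $ j\<bar> / 2"
    using irrational_divide_nat[OF irr(2), of N] N abs_divide_nat_le_half[OF N(1), of "e $ j"]
    by (simp_all add: y_def abs_divide)
  \<comment> \<open>The second shear meets the \<open>j\<close>-difference already contracted to
    \<open>y\<close>, so its frequency is adapted to \<open>y\<close>.\<close>
  obtain \<nu>' where \<nu>': "q dvd \<nu>'"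
    "\<And>N. N \<ge> 2 \<Longrightarrow> \<exists>c. \<bar>c\<bar> \<le> 2 * \<bar>e $ i\<bar> \<and> (\<forall>s. bump c \<nu>' s (s + y) = e $ i / real N - e $ i)"
    using ex_contracting_bump[OF y(1) q, of "e $ i"] by blast
  obtain N' where N': "N' \<ge> 2" "\<bar>L * e $ i\<bar> / real N' < \<delta> / 2"
    using ex_nat_divide_less[of "\<delta> / 2" "L * e $ i"] \<delta> by auto
  obtain c' where c': "\<bar>c'\<bar> \<le> 2 * \<bar>e $ i\<bar>" "\<And>s. bump c' \<nu>' s (s + y) = e $ i / real N' - e $ i"
    using \<nu>'(2)[OF N'(1)] by blast
  define x where "x = e $ i / real N'"
  have x: "x \<notin> \<rat>" "L * \<bar>x\<bar> < \<delta> / 2" "\<bar>x\<bar> \<le> \<bar>e $ i\<bar> / 2"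
    using irrational_divide_nat[OF irr(1), of N'] N' L abs_divide_nat_le_half[OF N'(1), of "e $ i"]
    by (simp_all add: x_def abs_divide abs_mult)
  define \<phi> where "\<phi> = bump c \<nu> (P $ i)"
  define \<psi> where "\<psi> = bump c' \<nu>' (P $ j)"
  define S1 T1 S2 T2 where "S1 = shear i j (\<lambda>t. - \<phi> t)" and "T1 = shear i j \<phi>"
    and "S2 = shear j i (\<lambda>t. - \<psi> t)" and "T2 = shear j i \<psi>"
  note comps = S1_def T1_def S2_def T2_def shear_component
  define e' where "e' = (\<chi> k. if k = i then x else if k = j then y else 0)"
  have e'_comp: "e' $ i = x" "e' $ j = y" "\<And>k. k \<noteq> i \<Longrightarrow> k \<noteq> j \<Longrightarrow> e' $ k = 0"
    using ij by (simp_all add: e'_def)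
  have "\<phi> (P $ i) = 0" "\<phi> (P $ i + e $ i) = y - e $ j" "\<psi> (P $ j) = 0" "\<psi> (P $ j + y) = x - e $ i"
    by (simp_all add: \<phi>_def \<psi>_def c(2) c'(2) x_def) (simp add: y_def)
  then have TP: "T2 (T1 P) = P" "T2 (T1 (P + e)) = P + e'"
    using ij e0 e'_comp by (auto simp: vec_eq_iff comps)
  \<comment> \<open>\<open>P\<close> is the midpoint of \<open>a\<close> and \<open>a + e'\<close>.
    As \<open>\<psi>\<close> is even about \<open>P $ j\<close>, \<open>S2\<close> moves both points
    by the same vector, and only the distortion by \<open>S1\<close> remains.\<close>
  define a where "a = P - e' /\<^sub>R 2"
  have a: "S2 (a + e') = S2 a + e'"
  proof -
    have "\<psi> (P $ j - y / 2) = \<psi> (P $ j + y / 2)" by (simp add: \<psi>_def bump_symmetric)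
    moreover have "a $ j = P $ j - y / 2" "a $ j + e' $ j = P $ j + y / 2"
      by (simp_all add: a_def e'_comp)
    ultimately have "\<psi> (a $ j + e' $ j) = \<psi> (a $ j)" by (simp only:)
    then show ?thesis by (simp add: vec_eq_iff comps)
  qed
  show thesis
  proof (rule that[of "\<lambda>z. S1 (S2 z)" "\<lambda>z. T2 (T1 z)" e' a])
    show "lattice_diffeo q (\<lambda>z. S1 (S2 z)) (\<lambda>z. T2 (T1 z))"
      unfolding S1_def S2_def T1_def T2_def \<phi>_def \<psi>_def
      by (rule lattice_diffeo_compose[OF lattice_diffeo_shear[OF ij \<nu>(1)] lattice_diffeo_shear[OF ij[symmetric] \<nu>'(1)]])
    show "T2 (T1 (P + e)) - T2 (T1 P) = e'" by (simp add: TP)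
    show "irrational_pair i j e'" "\<bar>e' $ i\<bar> \<le> \<bar>e $ i\<bar> / 2" "\<bar>e' $ j\<bar> \<le> \<bar>e $ j\<bar> / 2"
      using x y by (simp_all add: irrational_pair_def e'_comp)
    show "norm (T2 (T1 z) - z) \<le> 2 * (\<bar>e $ i\<bar> + \<bar>e $ j\<bar>)" for z
    proof -
      let ?v = "T2 (T1 z) - z"
      have "norm ?v \<le> \<bar>?v $ i\<bar> + \<bar>?v $ j\<bar>"
        by (rule norm_two_components[OF ij]) (simp add: comps)
      moreover have "\<bar>?v $ i\<bar> \<le> 2 * \<bar>e $ i\<bar>"
        using order_trans[OF bump_bound c'(1)] ij by (simp add: comps \<psi>_def)
      moreover have "\<bar>?v $ j\<bar> \<le> 2 * \<bar>e $ j\<bar>"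
        using order_trans[OF bump_bound c(1)] ij by (simp add: comps \<phi>_def)
      ultimately show ?thesis by simp
    qed
    show "norm (S1 (S2 (a + e')) - S1 (S2 a)) < \<delta>"
    proof -
      let ?b = "S2 a"
      let ?v = "S1 (?b + e') - S1 ?b"
      have "norm ?v \<le> \<bar>?v $ i\<bar> + \<bar>?v $ j\<bar>"
        by (rule norm_two_components[OF ij]) (simp add: comps e'_comp)
      moreover have "?v $ i = x" using ij by (simp add: comps e'_comp)
      moreover have "?v $ j = y - (\<phi> (?b $ i + x) - \<phi> (?b $ i))" by (simp add: comps e'_comp)
      moreover have "\<bar>\<phi> (?b $ i + x) - \<phi> (?b $ i)\<bar> \<le> 2 * \<bar>e $ j\<bar> * (pi * real \<nu>) * \<bar>x\<bar>"
      proof -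
        have "\<bar>\<phi> (?b $ i + x) - \<phi> (?b $ i)\<bar> \<le> \<bar>c\<bar> * (pi * real \<nu>) * \<bar>x\<bar>"
          using bump_lipschitz[of c \<nu> "P $ i" "?b $ i + x" "?b $ i"] by (simp add: \<phi>_def)
        also have "\<dots> \<le> 2 * \<bar>e $ j\<bar> * (pi * real \<nu>) * \<bar>x\<bar>"
          by (intro mult_right_mono c(1)) simp_all
        finally show ?thesis .
      qed
      ultimately have "norm ?v \<le> \<bar>y\<bar> + L * \<bar>x\<bar>" by (simp add: L_def algebra_simps)
      then show ?thesis using x(2) y(2) by (simp add: a)
    qed
  qed
qed

lemma approximation_step:
  fixes H K :: "real ^ 'n \<Rightarrow> real ^ 'n" and w :: "real ^ 'n"
  assumes HK: "lattice_diffeo 1 H K" and q: "q > 0" "real q *\<^sub>R w \<in> int_lattice"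
    and ij: "i \<noteq> j" and e: "irrational_pair i j (K p' - K p)" and pos: "\<eta> > 0" "\<epsilon> > 0"
  obtains H' K' w' q' where "lattice_diffeo 1 H' K'" "L < (q' :: nat)" "real q' *\<^sub>R w' \<in> int_lattice"
    "norm (w' - w) \<le> \<eta>"
    "Ck_close n \<eta> (conj_translation H' K' w') (conj_translation H K w)"
    "Ck_close n \<eta> (conj_translation H' K' (- w')) (conj_translation H K (- w))"
    "\<And>z. norm (K' z - K z) \<le> 2 * (\<bar>(K p' - K p) $ i\<bar> + \<bar>(K p' - K p) $ j\<bar>)"
    "irrational_pair i j (K' p' - K' p)"
    "\<bar>(K' p' - K' p) $ i\<bar> \<le> \<bar>(K p' - K p) $ i\<bar> / 2" "\<bar>(K' p' - K' p) $ j\<bar> \<le> \<bar>(K p' - K p) $ j\<bar> / 2"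
    "orbit_dense \<epsilon> (conj_translation H' K' w')" "near_collision p p' (3 * \<epsilon>) (conj_translation H' K' w')"
proof -
  note HKD = lattice_diffeoD[OF HK]
  \<comment> \<open>This \<open>\<delta>\<close> belongs to the old \<open>H\<close>: once
    \<open>S\<close> brings two points within \<open>\<delta>\<close>, the new map \<open>H'\<close>
    brings them within \<open>\<epsilon>\<close>.\<close>
  obtain \<delta> where \<delta>: "\<delta> > 0" "\<And>x y. norm (x - y) < \<delta> \<Longrightarrow> norm (H x - H y) < \<epsilon>"
    using equivariant_uniformly_continuous[OF HKD(7) smooth_continuous[OF HKD(1)] pos(2)] by blast
  obtain S T a e' where ST: "lattice_diffeo q S T" "T (K p + (K p' - K p)) - T (K p) = e'"
    "irrational_pair i j e'" "\<bar>e' $ i\<bar> \<le> \<bar>(K p' - K p) $ i\<bar> / 2" "\<bar>e' $ j\<bar> \<le> \<bar>(K p' - K p) $ j\<bar> / 2"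
    "\<And>x. norm (T x - x) \<le> 2 * (\<bar>(K p' - K p) $ i\<bar> + \<bar>(K p' - K p) $ j\<bar>)"
    "norm (S (a + e') - S a) < \<delta>"
    using ex_contracting_diffeo[OF ij q(1) e \<delta>(1), of "K p"] by metis
  define H' K' where "H' = (\<lambda>x. H (S x))" and "K' = (\<lambda>x. T (K x))"
  have HK': "lattice_diffeo 1 H' K'"
    unfolding H'_def K'_def by (rule lattice_diffeo_compose[OF HK lattice_diffeo_one[OF ST(1)]])
  note D = lattice_diffeoD[OF HK']
  have e': "K' p' - K' p = e'" using ST(2) by (simp add: K'_def)
  \<comment> \<open>\<open>S\<close> commutes with the translations by \<open>w\<close> and
    \<open>- w\<close>, so it cancels against \<open>T\<close> and the conjugated translations are
    unchanged.\<close>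
  have "S (T x + w) = x + w" "S (T x - w) = x - w" for x
    using lattice_diffeoD(9)[OF ST(1) q(2), of "T x"] lattice_diffeoD(9)[OF ST(1), of "- w" "T x"]
      int_lattice_minus[OF q(2)] lattice_diffeoD(5)[OF ST(1)] by simp_all
  then have conj: "conj_translation H' K' w = conj_translation H K w"
    "conj_translation H' K' (- w) = conj_translation H K (- w)"
    by (simp_all add: conj_translation_def H'_def K'_def fun_eq_iff)
  \<comment> \<open>Orbits of the new rotation must be dense at the scale of \<open>H'\<close>,
    which is known only after the shears are chosen.\<close>
  obtain \<delta>' where \<delta>': "\<delta>' > 0" "\<And>x y. norm (x - y) < \<delta>' \<Longrightarrow> norm (H' x - H' y) < \<epsilon>"
    using equivariant_uniformly_continuous[OF D(7) smooth_continuous[OF D(1)] pos(2)] by blast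
  have close: "\<forall>\<^sub>F v in nhds v0. Ck_close n \<eta> (conj_translation H' K' v) (conj_translation H' K' v0)" for v0
    by (rule Ck_close_conj_translation[OF D(1,2,7,8) pos(1)])
  obtain \<rho> where \<rho>: "\<rho> > 0"
    "\<And>v. dist v w < \<rho> \<Longrightarrow> Ck_close n \<eta> (conj_translation H' K' v) (conj_translation H' K' w)"
    using close[of w] unfolding eventually_nhds_metric by blast
  obtain \<rho>' where \<rho>': "\<rho>' > 0"
    "\<And>v. dist v (- w) < \<rho>' \<Longrightarrow> Ck_close n \<eta> (conj_translation H' K' v) (conj_translation H' K' (- w))"
    using close[of "- w"] unfolding eventually_nhds_metric by blast
  have "min (min \<rho> \<rho>') (min \<delta>' \<eta>) > 0" using \<rho>(1) \<rho>'(1) \<delta>'(1) pos by simp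
  then obtain w' q' N where w': "L < q'" "real q' *\<^sub>R w' \<in> int_lattice"
    "norm (w' - w) < min (min \<rho> \<rho>') (min \<delta>' \<eta>)"
    "\<And>z. \<exists>k\<le>N. \<exists>m\<in>int_lattice. norm (real k *\<^sub>R w' - z - m) < min (min \<rho> \<rho>') (min \<delta>' \<eta>)"
    using rational_dense_rotation[OF q] by metis
  have dense: "\<exists>k\<le>N. \<exists>m\<in>int_lattice. norm (real k *\<^sub>R w' - z - m) < \<delta>'" for z
    using w'(4)[of z] by auto
  have "norm (- w' + w) < \<rho>'" using w'(3) norm_minus_commute[of w' w] by simp
  show thesis
  proof (rule that[of H' K' q' w'])
    show "Ck_close n \<eta> (conj_translation H' K' w') (conj_translation H K w)"
      using \<rho>(2)[of w'] w'(3) by (simp add: conj dist_norm)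
    show "Ck_close n \<eta> (conj_translation H' K' (- w')) (conj_translation H K (- w))"
      using \<rho>'(2)[of "- w'"] \<open>norm (- w' + w) < \<rho>'\<close> by (simp add: conj dist_norm)
    show "orbit_dense \<epsilon> (conj_translation H' K' w')"
      by (rule orbit_dense_conj_translation[OF D(5,6,7) \<delta>'(2) dense])
    have "norm (H' (a + (K' p' - K' p)) - H' a) < \<epsilon>"
      unfolding e' H'_def by (rule \<delta>(2)[OF ST(7)])
    then show "near_collision p p' (3 * \<epsilon>) (conj_translation H' K' w')"
      using near_collision_conj_translation[where H = H' and K = K' and \<delta> = \<delta>' and N = N and w = w'
          and a = a and p = p and q = p' and \<epsilon> = \<epsilon>] D(5,6,7) \<delta>'(2) dense by blast
    show "norm (K' z - K z) \<le> 2 * (\<bar>(K p' - K p) $ i\<bar> + \<bar>(K p' - K p) $ j\<bar>)" for z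
      unfolding K'_def by (rule ST(6))
  qed (use HK' w' ST(3-5) in \<open>simp_all add: e'\<close>)
qed

section \<open>Limits of sequences with halving errors\<close>

text \<open>Since \<open>d n / 2 \<le> d n - d (Suc n)\<close>, the step bounds telescope and
  \<open>d n\<close> bounds the whole tail. The threshold \<open>n0\<close> is there for
  derivatives, which are controlled only from the stage equal to their order.\<close>

lemma halving_limit:
  fixes X :: "nat \<Rightarrow> 'a \<Rightarrow> 'b::banach"
  assumes d0: "\<And>n. 0 \<le> d n" and d: "\<And>n. d (Suc n) \<le> d n / 2"
    and X: "\<And>n x. n \<ge> n0 \<Longrightarrow> norm (X (Suc n) x - X n x) \<le> d n / 2"
  obtains l where "uniform_limit UNIV X l sequentially" "\<And>n x. n \<ge> n0 \<Longrightarrow> norm (l x - X n x) \<le> d n"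
proof -
  have tele: "norm (X (n + k) x - X n x) \<le> d n - d (n + k)" if "n \<ge> n0" for n k x
  proof (induction k)
    case (Suc k)
    have "norm (X (n + Suc k) x - X n x) \<le> norm (X (Suc (n + k)) x - X (n + k) x) + norm (X (n + k) x - X n x)"
      using norm_triangle_ineq[of "X (Suc (n + k)) x - X (n + k) x" "X (n + k) x - X n x"] by simp
    then show ?case using Suc X[of "n + k" x] d[of "n + k"] that by simp
  qed simp
  then have tele': "norm (X m x - X n x) \<le> d n" if "n \<ge> n0" "m \<ge> n" for m n x
    using tele[OF that(1), of "m - n" x] d0[of m] that(2) by simp
  have "d n \<le> d 0 * (1 / 2) ^ n" for n
  proof (induction n)
    case (Suc n)
    then show ?case using d[of n] by simp
  qed simp
  then have "\<forall>\<^sub>F n in sequentially. norm (d n) \<le> d 0 * (1 / 2) ^ n"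
    using d0 by simp
  moreover have "(\<lambda>n. d 0 * (1 / 2 :: real) ^ n) \<longlonglongrightarrow> 0"
    by (intro tendsto_mult_right_zero LIMSEQ_power_zero) simp
  ultimately have dlim: "d \<longlonglongrightarrow> 0" by (rule Lim_null_comparison)
  have small: "\<exists>N\<ge>n0. d N < \<epsilon>" if "\<epsilon> > 0" for \<epsilon>
  proof -
    have "\<forall>\<^sub>F n in sequentially. d n < \<epsilon> \<and> n \<ge> n0"
      using order_tendstoD(2)[OF dlim that] eventually_ge_at_top by (rule eventually_conj)
    then show ?thesis using eventually_happens'[OF sequentially_bot] by blast
  qed
  have "convergent (\<lambda>n. X n x)" for x
  proof (rule Cauchy_convergent, rule metric_CauchyI)
    fix \<epsilon> :: real assume "\<epsilon> > 0"
    then obtain N where N: "N \<ge> n0" "d N < \<epsilon> / 2" using small[of "\<epsilon> / 2"] by auto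
    have "dist (X m x) (X n x) < \<epsilon>" if "m \<ge> N" "n \<ge> N" for m n
      using dist_triangle2[of "X m x" "X n x" "X N x"] tele'[OF N(1) that(1), of x] tele'[OF N(1) that(2), of x] N(2)
      by (simp add: dist_norm)
    then show "\<exists>M. \<forall>m\<ge>M. \<forall>n\<ge>M. dist (X m x) (X n x) < \<epsilon>" by blast
  qed
  then have lim: "(\<lambda>n. X n x) \<longlonglongrightarrow> lim (\<lambda>n. X n x)" for x by (simp add: convergent_LIMSEQ_iff)
  have bound: "norm (lim (\<lambda>n. X n x) - X n x) \<le> d n" if "n \<ge> n0" for n x
  proof (rule Lim_norm_ubound[OF sequentially_bot])
    show "(\<lambda>m. X m x - X n x) \<longlonglongrightarrow> lim (\<lambda>n. X n x) - X n x" by (intro tendsto_diff lim tendsto_const)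
    show "\<forall>\<^sub>F m in sequentially. norm (X m x - X n x) \<le> d n"
      using eventually_ge_at_top[of n] by eventually_elim (rule tele'[OF that])
  qed
  have "uniform_limit UNIV X (\<lambda>x. lim (\<lambda>n. X n x)) sequentially"
  proof (rule uniform_limitI)
    fix \<epsilon> :: real assume "\<epsilon> > 0"
    have "\<forall>\<^sub>F n in sequentially. d n < \<epsilon>" "\<forall>\<^sub>F n in sequentially. n \<ge> n0"
      using order_tendstoD(2)[OF dlim \<open>\<epsilon> > 0\<close>] by (auto simp: eventually_ge_at_top)
    then show "\<forall>\<^sub>F n in sequentially. \<forall>x\<in>UNIV. dist (X n x) (lim (\<lambda>n. X n x)) < \<epsilon>"
      by eventually_elim (use bound in \<open>auto simp: dist_norm norm_minus_commute intro: order_le_less_trans\<close>)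
  qed
  then show thesis using that bound by blast
qed

text \<open>This passes to the limit in compositions where the map and its argument both depend on
  \<open>n\<close>, as in the inverse relations and the semi-conjugacy.\<close>

lemma uniform_limit_diagonal:
  fixes X :: "nat \<Rightarrow> 'a::topological_space \<Rightarrow> 'b::real_normed_vector"
  assumes "uniform_limit UNIV X l sequentially" "continuous_on UNIV l" "y \<longlonglongrightarrow> y0"
  shows "(\<lambda>n. X n (y n)) \<longlonglongrightarrow> l y0"
proof -
  have "(\<lambda>n. X n (y n) - l (y n)) \<longlonglongrightarrow> 0"
  proof (rule tendstoI)
    fix \<epsilon> :: real assume "\<epsilon> > 0"
    from uniform_limitD[OF assms(1) this]
    show "\<forall>\<^sub>F n in sequentially. dist (X n (y n) - l (y n)) 0 < \<epsilon>"
      by eventually_elim (simp add: dist_norm)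
  qed
  moreover have "(\<lambda>n. l (y n)) \<longlonglongrightarrow> l y0"
    by (rule continuous_on_tendsto_compose[OF assms(2,3)]) auto
  ultimately show ?thesis using tendsto_add by fastforce
qed

text \<open>The displacement of an equivariant map is periodic, so its bound on the compact unit
  cube is global.\<close>

lemma equivariant_bounded_displacement:
  fixes h :: "real ^ 'n \<Rightarrow> real ^ 'n"
  assumes "equivariant h" "continuous_on UNIV h"
  obtains B where "\<And>x. norm (h x - x) \<le> B"
proof -
  have "compact ((\<lambda>x. h x - x) ` cbox 0 1)"
    using continuous_on_diff[OF assms(2) continuous_on_id]
    by (intro compact_continuous_image compact_cbox) (rule continuous_on_subset, auto)
  then have "bounded ((\<lambda>x. h x - x) ` cbox 0 1)" by (rule compact_imp_bounded)
  then obtain B where "\<forall>v\<in>(\<lambda>x. h x - x) ` cbox 0 1. norm v \<le> B"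
    unfolding bounded_iff by blast
  then have B: "norm (h x - x) \<le> B" if "x \<in> cbox 0 1" for x using that by blast
  have "norm (h x - x) \<le> B" for x
  proof -
    have "x - vfloor x \<in> cbox 0 1" using diff_vfloor_in_cube cube_subset by blast
    from B[OF this] show ?thesis by (simp add: equivariantD_diff[OF assms(1) vfloor_in_lattice])
  qed
  then show thesis using that by blast
qed

lemma orbit_dense_mono: "orbit_dense \<epsilon> F \<Longrightarrow> \<epsilon> \<le> \<epsilon>' \<Longrightarrow> orbit_dense \<epsilon>' F"
  unfolding orbit_dense_def by (meson order_less_le_trans)

lemma near_collision_mono: "near_collision p q \<epsilon> F \<Longrightarrow> \<epsilon> \<le> \<epsilon>' \<Longrightarrow> near_collision p q \<epsilon>' F"
  unfolding near_collision_def by (meson order_less_le_trans)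

section \<open>The construction\<close>

type_synonym 'n stage =
  "(real ^ 'n \<Rightarrow> real ^ 'n) \<times> (real ^ 'n \<Rightarrow> real ^ 'n) \<times> (real ^ 'n) \<times> nat \<times> real"

text \<open>
  In a stage \<open>(H, K, w, q, \<eta>)\<close>, \<open>K\<close> is the inverse of \<open>H\<close>, \<open>q\<close> is a common denominator of the
  coordinates of \<open>w\<close>, and \<open>\<eta>\<close> bounds the total change made in all later stages.
\<close>

fun stage :: "'n::finite \<Rightarrow> 'n \<Rightarrow> real ^ 'n \<Rightarrow> nat \<Rightarrow> 'n stage \<Rightarrow> bool" where
  "stage i j p n (H, K, w, q, \<eta>) \<longleftrightarrow>
    lattice_diffeo 1 H K \<and> n < q \<and> real q *\<^sub>R w \<in> int_lattice \<and>
    irrational_pair i j (K p - K 0) \<and>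
    \<bar>(K p - K 0) $ i\<bar> \<le> 1 / 2 ^ n \<and> \<bar>(K p - K 0) $ j\<bar> \<le> 1 / 2 ^ n \<and>
    \<eta> > 0 \<and> real q * \<eta> \<le> exp (- (real n * real q)) \<and>
    (n > 0 \<longrightarrow> (\<forall>G. (\<forall>x. norm (G x - conj_translation H K w x) \<le> \<eta>) \<longrightarrow>
      orbit_dense (1 / real n) G \<and> near_collision 0 p (1 / real n) G))"

text \<open>The order of closeness grows with the stage, so each derivative is eventually
  controlled. The clause for \<open>- w\<close> makes the inverses converge as well, and the
  summable bound on \<open>K\<close> yields the semi-conjugacy.\<close>

fun refines :: "nat \<Rightarrow> 'n::finite stage \<Rightarrow> 'n stage \<Rightarrow> bool" where
  "refines n (H, K, w, q, \<eta>) (H', K', w', q', \<eta>') \<longleftrightarrow>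
    \<eta>' \<le> \<eta> / 2 \<and> norm (w' - w) \<le> \<eta> / 2 \<and>
    Ck_close n (\<eta> / 2) (conj_translation H' K' w') (conj_translation H K w) \<and>
    Ck_close n (\<eta> / 2) (conj_translation H' K' (- w')) (conj_translation H K (- w)) \<and>
    (\<forall>z. norm (K' z - K z) \<le> 4 / 2 ^ n)"

lemma conj_translation_lattice_diffeo:
  assumes "lattice_diffeo 1 H K"
  shows "smooth (conj_translation H K w)" "equivariant (conj_translation H K w)"
    "volume_preserving (conj_translation H K w)"
    "conj_translation H K w (conj_translation H K (- w) x) = x"
proof -
  note D = lattice_diffeoD[OF assms]
  show "smooth (conj_translation H K w)"
    unfolding conj_translation_def[abs_def]
    by (rule smooth_compose[OF D(1) smooth_add[OF D(2) smooth_const]])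
  show "equivariant (conj_translation H K w)"
    unfolding conj_translation_def[abs_def]
    by (rule equivariant_compose[OF D(7) equivariant_translation[OF D(8)]])
  show "volume_preserving (conj_translation H K w)"
    unfolding conj_translation_def[abs_def]
    by (rule volume_preserving_compose[OF D(3) volume_preserving_compose[OF volume_preserving_translation D(4)]])
  show "conj_translation H K w (conj_translation H K (- w) x) = x"
    by (simp add: conj_translation_def D(5,6))
qed

lemma stage_refinement:
  fixes s :: "'n::finite stage"
  assumes ij: "i \<noteq> j" and s: "stage i j p n s"
  shows "\<exists>s'. stage i j p (Suc n) s' \<and> refines n s s'"
proof -
  obtain H K w q \<eta> where s_eq: "s = (H, K, w, q, \<eta>)" by (cases s)
  note st = s[unfolded s_eq stage.simps]
  \<comment> \<open>The collision bound is weakened by a factor 3 in the inductive step and again by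
    robustness, hence the 9.\<close>
  let ?e = "K p - K 0" and ?\<epsilon> = "1 / (9 * real (Suc n))"
  have "lattice_diffeo 1 H K" "q > 0" "real q *\<^sub>R w \<in> int_lattice" "irrational_pair i j (K p - K 0)"
    "\<eta> / 2 > 0" "?\<epsilon> > 0"
    using st by auto
  note step = approximation_step[OF this(1-3) ij this(4-6)]
  obtain H' K' w' q' where HK': "lattice_diffeo 1 H' K'" and q': "Suc n < q'" "real q' *\<^sub>R w' \<in> int_lattice"
    and w': "norm (w' - w) \<le> \<eta> / 2"
    and close: "Ck_close n (\<eta> / 2) (conj_translation H' K' w') (conj_translation H K w)"
      "Ck_close n (\<eta> / 2) (conj_translation H' K' (- w')) (conj_translation H K (- w))"
    and K': "\<And>z. norm (K' z - K z) \<le> 2 * (\<bar>?e $ i\<bar> + \<bar>?e $ j\<bar>)"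
    and e': "irrational_pair i j (K' p - K' 0)"
      "\<bar>(K' p - K' 0) $ i\<bar> \<le> \<bar>?e $ i\<bar> / 2" "\<bar>(K' p - K' 0) $ j\<bar> \<le> \<bar>?e $ j\<bar> / 2"
    and dense: "orbit_dense ?\<epsilon> (conj_translation H' K' w')"
      "near_collision 0 p (3 * ?\<epsilon>) (conj_translation H' K' w')"
    by (rule step[of "Suc n" n]) (rule that)
  let ?F = "conj_translation H' K' w'"
  have F: "equivariant ?F" "continuous_on UNIV ?F"
    using conj_translation_lattice_diffeo[OF HK'] smooth_continuous by blast+
  obtain \<eta>1 where \<eta>1: "\<eta>1 > 0" "\<And>G. (\<forall>x. norm (G x - ?F x) \<le> \<eta>1) \<Longrightarrow> orbit_dense (2 * ?\<epsilon>) G"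
    using orbit_dense_robust[OF F _ dense(1)] by auto
  obtain \<eta>2 where \<eta>2: "\<eta>2 > 0" "\<And>G. (\<forall>x. norm (G x - ?F x) \<le> \<eta>2) \<Longrightarrow> near_collision 0 p (3 * (3 * ?\<epsilon>)) G"
    using near_collision_robust[OF F _ dense(2)] by auto
  \<comment> \<open>The four bounds serve density, proximality, halving of the error, and the
    super-Liouvillean rate.\<close>
  define \<eta>' where "\<eta>' = min (min \<eta>1 \<eta>2) (min (\<eta> / 2) (exp (- (real (Suc n) * real q')) / real q'))"
  have \<eta>'_pos: "\<eta>' > 0" using \<eta>1(1) \<eta>2(1) q'(1) st by (simp add: \<eta>'_def)
  have \<eta>': "\<eta>' \<le> \<eta>1" "\<eta>' \<le> \<eta>2" "\<eta>' \<le> \<eta> / 2"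
    unfolding \<eta>'_def by linarith+
  have "\<eta>' \<le> exp (- (real (Suc n) * real q')) / real q'" by (simp add: \<eta>'_def)
  then have q\<eta>': "real q' * \<eta>' \<le> exp (- (real (Suc n) * real q'))"
    using q'(1) by (simp add: field_simps)
  have e: "\<bar>?e $ i\<bar> \<le> 1 / 2 ^ n" "\<bar>?e $ j\<bar> \<le> 1 / 2 ^ n" using st by blast+
  have "orbit_dense (1 / real (Suc n)) G \<and> near_collision 0 p (1 / real (Suc n)) G"
    if G: "\<forall>x. norm (G x - ?F x) \<le> \<eta>'" for G
  proof
    have "orbit_dense (2 * ?\<epsilon>) G" "near_collision 0 p (3 * (3 * ?\<epsilon>)) G"
      using G \<eta>'(1,2) by (meson \<eta>1(2) \<eta>2(2) order_trans)+
    moreover have "2 * ?\<epsilon> \<le> 1 / real (Suc n)" "3 * (3 * ?\<epsilon>) \<le> 1 / real (Suc n)"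
      by (simp_all add: field_simps)
    ultimately show "orbit_dense (1 / real (Suc n)) G" "near_collision 0 p (1 / real (Suc n)) G"
      using orbit_dense_mono near_collision_mono by blast+
  qed
  moreover have "\<bar>(K' p - K' 0) $ i\<bar> \<le> 1 / 2 ^ Suc n" "\<bar>(K' p - K' 0) $ j\<bar> \<le> 1 / 2 ^ Suc n"
    using e e'(2,3) by simp_all
  ultimately have "stage i j p (Suc n) (H', K', w', q', \<eta>')"
    unfolding stage.simps using HK' q' e'(1) \<eta>'_pos q\<eta>' by blast
  moreover have "norm (K' z - K z) \<le> 4 / 2 ^ n" for z
    using K'[of z] e by simp
  then have "refines n s (H', K', w', q', \<eta>')"
    unfolding s_eq refines.simps using \<eta>'(3) w' close by blast
  ultimately show ?thesis by blast
qed

theorem theorem5: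
  assumes "CARD('n::finite) \<ge> 2"
  shows "\<exists>(f :: 'n torus \<Rightarrow> 'n torus) (w :: real ^ 'n).
    smooth_torus_diffeo f \<and>
    lebesgue_preserving f \<and>
    minimal_map f \<and>
    semiconj_to_translation_htpy_id f \<and>
    \<not> conj_to_translation f \<and>
    has_rotation_vector f (torus_proj w) \<and>
    super_liouvillean w"
proof -
  obtain i j :: 'n where ij: "i \<noteq> j"
    using assms card_le_Suc0_iff_eq[of "UNIV :: 'n set"] by (auto simp: numeral_2_eq_2 not_less_eq_eq)
  \<comment> \<open>An irrational \<open>r\<close> below 1 gives an admissible initial difference
    \<open>p\<close> whose coordinates meet the bound \<open>1 / 2 ^ 0\<close>; it also keeps
    \<open>p\<close> out of the lattice.\<close>
  obtain r :: real where r: "0 < r" "r < 1" "r \<notin> \<rat>"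
    using real_interval_avoid_countable_set[OF zero_less_one countable_rat] by auto
  define p :: "real ^ 'n" where "p = (\<chi> k. if k = i \<or> k = j then r else 0)"
  have p: "irrational_pair i j p" using r(3) by (simp add: irrational_pair_def p_def)
  have "p $ i \<notin> \<int>" using r(3) Ints_subset_Rats by (auto simp: p_def)
  then have p_lattice: "0 - p \<notin> int_lattice" by (auto simp: int_lattice_def)
  \<comment> \<open>The induction starts from the identity with rotation 0. Density and proximality
    are demanded only from stage 1 on.\<close>
  have "stage i j p 0 (\<lambda>x. x, \<lambda>x. x, 0, 1, 1)"
    using p r by (simp add: lattice_diffeo_id p_def)
  then have "\<exists>s. \<forall>n. stage i j p n (s n) \<and> refines n (s n) (s (Suc n))"
    using stage_refinement[OF ij] by (intro dependent_nat_choice) blast+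
  then obtain s where s: "\<And>n. stage i j p n (s n)" "\<And>n. refines n (s n) (s (Suc n))" by blast
  define H where "H n = fst (s n)" for n
  define K where "K n = fst (snd (s n))" for n
  define v where "v n = fst (snd (snd (s n)))" for n
  define q where "q n = fst (snd (snd (snd (s n))))" for n
  define \<eta> where "\<eta> n = snd (snd (snd (snd (s n))))" for n
  have s_eq: "s n = (H n, K n, v n, q n, \<eta> n)" for n
    by (simp add: H_def K_def v_def q_def \<eta>_def)
  define X where "X n = conj_translation (H n) (K n) (v n)" for n
  define Y where "Y n = conj_translation (H n) (K n) (- v n)" for n
  have HK: "lattice_diffeo 1 (H n) (K n)" and q: "n < q n" and qv: "real (q n) *\<^sub>R v n \<in> int_lattice"
    and \<eta>: "0 < \<eta> n" and q\<eta>: "real (q n) * \<eta> n \<le> exp (- (real n * real (q n)))" for n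
    using s(1)[of n] unfolding s_eq stage.simps by blast+
  have robust: "orbit_dense (1 / real n) G \<and> near_collision 0 p (1 / real n) G"
    if "n > 0" "\<And>x. norm (G x - X n x) \<le> \<eta> n" for n G
    using s(1)[of n] that unfolding s_eq stage.simps X_def by blast
  have \<eta>_half: "\<eta> (Suc n) \<le> \<eta> n / 2" and v_step: "norm (v (Suc n) - v n) \<le> \<eta> n / 2"
    and X_step: "Ck_close n (\<eta> n / 2) (X (Suc n)) (X n)" and Y_step: "Ck_close n (\<eta> n / 2) (Y (Suc n)) (Y n)"
    and K_step: "norm (K (Suc n) z - K n z) \<le> 4 / 2 ^ n" for n z
    using s(2)[of n] unfolding s_eq refines.simps X_def Y_def by blast+
  have \<eta>0: "0 \<le> \<eta> n" for n using \<eta>[of n] by simp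
  have XD: "smooth (X n)" "equivariant (X n)" "volume_preserving (X n)" "X n (Y n x) = x" for n x
    unfolding X_def Y_def by (rule conj_translation_lattice_diffeo[OF HK])+
  have YD: "smooth (Y n)" "equivariant (Y n)" "volume_preserving (Y n)" "Y n (X n x) = x" for n x
    using conj_translation_lattice_diffeo[OF HK, where w = "- v n"] by (simp_all add: X_def Y_def)
  \<comment> \<open>\<open>Ck_close n\<close> controls a derivative of order
    \<open>length vs\<close> from stage \<open>length vs\<close> on; the empty list gives the bound
    on the maps at all stages.\<close>
  have smooth_limit_exists: "\<exists>L. smooth L \<and> uniform_limit UNIV Z L sequentially \<and> (\<forall>n x. norm (L x - Z n x) \<le> \<eta> n)"
    if sm: "\<And>n. smooth (Z n)" and step: "\<And>n. Ck_close n (\<eta> n / 2) (Z (Suc n)) (Z n)"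
    for Z :: "nat \<Rightarrow> real ^ 'n \<Rightarrow> real ^ 'n"
  proof -
    have "\<exists>l. uniform_limit UNIV (\<lambda>n. ideriv vs (Z n)) l sequentially \<and> (\<forall>n\<ge>length vs. \<forall>x. norm (l x - ideriv vs (Z n) x) \<le> \<eta> n)"
      if "set vs \<subseteq> Basis" for vs
    proof -
      have step': "norm (ideriv vs (Z (Suc n)) x - ideriv vs (Z n) x) \<le> \<eta> n / 2" if "length vs \<le> n" for n x
        using step[of n] that \<open>set vs \<subseteq> Basis\<close> unfolding Ck_close_def by blast
      obtain l where "uniform_limit UNIV (\<lambda>n. ideriv vs (Z n)) l sequentially"
        "\<And>n x. length vs \<le> n \<Longrightarrow> norm (l x - ideriv vs (Z n) x) \<le> \<eta> n"
        by (rule halving_limit[of \<eta> "length vs" "\<lambda>n. ideriv vs (Z n)"])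
          (rule \<eta>0, rule \<eta>_half, erule step', rule that)
      then show ?thesis by blast
    qed
    then obtain L where L: "\<And>vs. set vs \<subseteq> Basis \<Longrightarrow> uniform_limit UNIV (\<lambda>n. ideriv vs (Z n)) (L vs) sequentially"
      "\<And>vs n x. set vs \<subseteq> Basis \<Longrightarrow> n \<ge> length vs \<Longrightarrow> norm (L vs x - ideriv vs (Z n) x) \<le> \<eta> n"
      by metis
    have "smooth (L [])" by (rule smooth_limit[OF sm L(1)])
    moreover have "uniform_limit UNIV Z (L []) sequentially" using L(1)[of "[]"] by simp
    moreover have "norm (L [] x - Z n x) \<le> \<eta> n" for n x using L(2)[of "[]" n x] by simp
    ultimately show ?thesis by blast
  qed
  obtain F where F: "smooth F" "uniform_limit UNIV X F sequentially" "\<And>n x. norm (F x - X n x) \<le> \<eta> n"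
    using smooth_limit_exists[OF XD(1) X_step] by blast
  obtain G where G: "smooth G" "uniform_limit UNIV Y G sequentially"
    using smooth_limit_exists[OF YD(1) Y_step] by blast
  obtain w where w: "\<And>n. norm (w - v n) \<le> \<eta> n" "v \<longlonglongrightarrow> w"
  proof -
    obtain l where l: "uniform_limit UNIV (\<lambda>n _ :: unit. v n) l sequentially" "\<And>n x. norm (l x - v n) \<le> \<eta> n"
      by (rule halving_limit[of \<eta> 0 "\<lambda>n _ :: unit. v n"]) (use \<eta>0 \<eta>_half v_step in simp_all)
    have "v \<longlonglongrightarrow> l ()" using tendsto_uniform_limitI[OF l(1), of "()"] by simp
    with l(2) show thesis by (rule that)
  qed
  \<comment> \<open>The steps are at most \<open>4 / 2 ^ n\<close>, which is half of the tail bound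
    \<open>8 / 2 ^ n\<close>.\<close>
  obtain h where h: "uniform_limit UNIV K h sequentially" "\<And>n x. norm (h x - K n x) \<le> 8 / 2 ^ n"
    by (rule halving_limit[of "\<lambda>n. 8 / 2 ^ n" 0 K]) (use K_step in simp_all)
  have contF: "continuous_on UNIV F" and contG: "continuous_on UNIV G"
    using smooth_continuous[OF F(1)] smooth_continuous[OF G(1)] .
  have conth: "continuous_on UNIV h"
    by (rule uniform_limit_theorem[OF _ h(1)]) (simp_all add: smooth_continuous[OF lattice_diffeoD(2)[OF HK]])
  have limF: "(\<lambda>n. X n x) \<longlonglongrightarrow> F x" and limG: "(\<lambda>n. Y n x) \<longlonglongrightarrow> G x" and limh: "(\<lambda>n. K n x) \<longlonglongrightarrow> h x" for x
    using tendsto_uniform_limitI[OF F(2)] tendsto_uniform_limitI[OF G(2)] tendsto_uniform_limitI[OF h(1)] by simp_all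
  have equivariant_limit: "equivariant L"
    if "\<And>n. equivariant (Z n)" "\<And>x. (\<lambda>n. Z n x) \<longlonglongrightarrow> L x" for Z and L :: "real ^ 'n \<Rightarrow> real ^ 'n"
    unfolding equivariant_def
  proof (intro allI ballI)
    fix x m :: "real ^ 'n" assume m: "m \<in> int_lattice"
    have "(\<lambda>n. Z n (x + m)) \<longlonglongrightarrow> L x + m"
      unfolding equivariantD[OF that(1) m] by (intro tendsto_add that(2) tendsto_const)
    then show "L (x + m) = L x + m" using that(2) LIMSEQ_unique by blast
  qed
  have eqF: "equivariant F" and eqG: "equivariant G" and eqh: "equivariant h"
    using equivariant_limit[OF XD(2) limF] equivariant_limit[OF YD(2) limG]
      equivariant_limit[OF lattice_diffeoD(8)[OF HK] limh] by blast+
  have FG: "F (G x) = x" for x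
    using uniform_limit_diagonal[OF F(2) contF limG, of x] XD(4) by (simp add: LIMSEQ_const_iff)
  have GF: "G (F x) = x" for x
    using uniform_limit_diagonal[OF G(2) contG limF, of x] YD(4) by (simp add: LIMSEQ_const_iff)
  have semi: "h (F x) = h x + w" for x
  proof -
    have "K n (X n x) = K n x + v n" for n
      by (simp add: X_def conj_translation_def lattice_diffeoD(6)[OF HK])
    then have "(\<lambda>n. K n x + v n) \<longlonglongrightarrow> h (F x)"
      using uniform_limit_diagonal[OF h(1) conth limF, of x] by simp
    moreover have "(\<lambda>n. K n x + v n) \<longlonglongrightarrow> h x + w" by (intro tendsto_add limh w(2))
    ultimately show ?thesis by (rule LIMSEQ_unique)
  qed
  obtain B where B: "\<And>x. norm (h x - x) \<le> B"
    using equivariant_bounded_displacement[OF eqh conth] by blast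
  have "surj h"
  proof (rule surjI)
    fix y
    have "\<exists>x. h x = y"
    proof -
      \<comment> \<open>The points \<open>H n y\<close> are approximate preimages, since
        \<open>K n (H n y) = y\<close> and \<open>h\<close> is close to \<open>K n\<close>. Bounded
        displacement confines them to a ball, and a cluster point is a preimage of
        \<open>y\<close>.\<close>
      have near: "norm (h (H n y) - y) \<le> 8 / 2 ^ n" for n
        using h(2)[of "H n y" n] by (simp add: lattice_diffeoD(6)[OF HK])
      have "H n y \<in> cball y (B + 8)" for n
      proof -
        have "(8 :: real) / 2 ^ n \<le> 8" by (simp add: divide_le_eq)
        then have "norm (H n y - y) \<le> B + 8"
          using norm_triangle_ineq4[of "h (H n y) - y" "h (H n y) - H n y"] near[of n] B[of "H n y"] by simp
        then show ?thesis by (simp add: dist_norm norm_minus_commute)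
      qed
      then obtain x r where x: "strict_mono r" "((\<lambda>n. H n y) \<circ> r) \<longlonglongrightarrow> x"
        using compact_cball[of y "B + 8"] unfolding compact_def by metis
      have "(\<lambda>n. h (H (r n) y)) \<longlonglongrightarrow> h x"
        by (rule continuous_on_tendsto_compose[OF conth x(2)[unfolded comp_def]]) auto
      moreover have "(\<lambda>n. h (H n y) - y) \<longlonglongrightarrow> 0"
      proof (rule Lim_null_comparison)
        show "\<forall>\<^sub>F n in sequentially. norm (h (H n y) - y) \<le> 8 * (1 / 2) ^ n"
          using near by (intro always_eventually allI) (simp add: power_divide)
        show "(\<lambda>n. 8 * (1 / 2 :: real) ^ n) \<longlonglongrightarrow> 0"
          by (intro tendsto_mult_right_zero LIMSEQ_power_zero) simp
      qed
      then have "(\<lambda>n. h (H n y)) \<longlonglongrightarrow> y" by (simp add: LIM_zero_iff)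
      then have "(\<lambda>n. h (H (r n) y)) \<longlonglongrightarrow> y"
        using LIMSEQ_subseq_LIMSEQ[of "\<lambda>n. h (H n y)" y r] x(1) by (simp add: comp_def)
      ultimately have "h x = y" by (rule LIMSEQ_unique)
      then show ?thesis by blast
    qed
    then show "h (SOME x. h x = y) = y" by (rule someI_ex)
  qed
  \<comment> \<open>\<open>F\<close> lies within \<open>\<eta> n\<close> of \<open>X n\<close> for
    every \<open>n\<close>, so it inherits the robust properties of all stages.\<close>
  have robustF: "orbit_dense \<epsilon> F" "near_collision 0 p \<epsilon> F" if \<epsilon>: "\<epsilon> > 0" for \<epsilon>
  proof -
    obtain n where n: "n > 0" "1 / real n < \<epsilon>"
      using reals_Archimedean[OF \<epsilon>] by (metis inverse_eq_divide zero_less_Suc)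
    then show "orbit_dense \<epsilon> F" "near_collision 0 p \<epsilon> F"
      using robust[OF n(1) F(3)] orbit_dense_mono near_collision_mono less_imp_le by blast+
  qed
  show ?thesis
  proof (intro exI conjI)
    show "smooth_torus_diffeo (torus_map F)"
      by (rule smooth_torus_diffeo_torus_map[OF F(1) G(1) eqF eqG FG GF])
    have "volume_preserving F"
      by (rule volume_preserving_limit[OF XD(3) limF contF YD(3) limG contG FG GF])
    then show "lebesgue_preserving (torus_map F)"
      by (rule lebesgue_preserving_torus_map[OF _ borel_measurable_continuous_onI[OF contG] eqF eqG contF GF])
    show "minimal_map (torus_map F)" by (rule minimal_torus_map[OF eqF robustF(1)])
    show "semiconj_to_translation_htpy_id (torus_map F)"
      by (rule semiconj_torus_map[OF eqF eqh conth semi \<open>surj h\<close>])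
    show "\<not> conj_to_translation (torus_map F)"
      by (rule not_conj_to_translation_torus_map[OF eqF p_lattice robustF(2)])
    show "has_rotation_vector (torus_map F) (torus_proj w)"
      by (rule has_rotation_vector_torus_map[OF eqF contF semi B])
    show "super_liouvillean w"
    proof (rule super_liouvilleanI[OF q qv])
      fix n
      have "real (q n) * norm (w - v n) \<le> real (q n) * \<eta> n" by (intro mult_left_mono w(1)) simp
      then show "real (q n) * norm (w - v n) \<le> exp (- (real n * real (q n)))"
        using q\<eta>[of n] by simp
    qed
  qed
qed

end
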